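(* Let $B$ be a complete Boolean algebra. If player II has a winning strategy in the cut and choose game $\mathcal G_{c\&c}$ played on $B$, then $B$ is semiproper.
   Context: The cut and choose game $\mathcal G_{c\&c}$ on a complete Boolean algebra $B$: player I first plays a nonzero $p\in B$ together with $b_0\in B$; II answers $r_0\in\{0,1\}$; then I plays $b_1\in B$, II answers $r_1\in\{0,1\}$, and so on for $\omega$ moves. II wins the run if $p\wedge\bigwedge_{i<\omega,\ r_i=1} b_i-\bigvee_{i<\omega,\ r_i=0} b_i\neq 0$. A winning strategy for II is a function assigning to each finite partial play (with the last move by I) a response in $\{0,1\}$ such that II wins every run played according to it. $B$ is semiproper if for all sufficiently large regular $\theta$ there are club many countable $N\prec H_\theta$ with $B\in N$ such that for every $p\in N\cap B$, $p\neq 0$, there is $0\neq q\le p$ forcing $N[\dot G]\cap\omega_1=N\cap\omega_1$. *)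

theory Defs
  imports "HOL-Algebra.Complete_Lattice" "HOL-Library.Countable_Set"
begin

unbundle cardinal_syntax

section \<open>A universe of hereditary sets\<close>

text \<open>
  HOL has no type of all sets, so sets in the sense of ZFC are represented as well-founded trees
  up to bisimulation. With partial branching indexed by \<^typ>\<open>'u + nat\<close> one obtains all sets
  that are hereditarily of cardinality at most \<open>\<kappa> = max |'u| \<aleph>\<^sub>0\<close>, that is, the structure
  \<open>H(\<kappa>\<^sup>+)\<close>. The type \<open>'u\<close> is a type variable throughout, so the universe is arbitrarily large.
\<close>

datatype 'u tree = Tree "'u + nat \<Rightarrow> 'u tree option"

primrec children :: "'u tree \<Rightarrow> 'u tree set" where
  "children (Tree f) = {t. \<exists>i. f i = Some t}"

inductive bisim :: "'u tree \<Rightarrow> 'u tree \<Rightarrow> bool" where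
  bisimI: "(\<And>s'. s' \<in> children s \<Longrightarrow> \<exists>t' \<in> children t. bisim s' t') \<Longrightarrow>
    (\<And>t'. t' \<in> children t \<Longrightarrow> \<exists>s' \<in> children s. bisim s' t') \<Longrightarrow> bisim s t"

lemma children_induct:
  assumes "\<And>t. (\<And>s. s \<in> children t \<Longrightarrow> P s) \<Longrightarrow> P t"
  shows "P t"
proof (induction t)
  case (Tree f)
  show ?case
  proof (rule assms)
    fix s assume "s \<in> children (Tree f)"
    then obtain i where "f i = Some s" by auto
    then show "P s" using Tree[of "f i" s] by (metis option.set_intros rangeI)
  qed
qed

lemma bisim_iff:
  "bisim s t \<longleftrightarrow> (\<forall>s' \<in> children s. \<exists>t' \<in> children t. bisim s' t') \<and>
     (\<forall>t' \<in> children t. \<exists>s' \<in> children s. bisim s' t')"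
  by (subst bisim.simps) blast

lemma bisim_refl: "bisim t t"
  by (induction t rule: children_induct) (subst bisim_iff, blast)

lemma bisim_sym: "bisim s t \<Longrightarrow> bisim t s"
  by (induction rule: bisim.induct) (subst bisim_iff, blast)

lemma bisim_trans: "bisim s t \<Longrightarrow> bisim t u \<Longrightarrow> bisim s u"
proof (induction s arbitrary: t u rule: children_induct)
  case (1 s)
  have st: "\<forall>s' \<in> children s. \<exists>t' \<in> children t. bisim s' t'"
      "\<forall>t' \<in> children t. \<exists>s' \<in> children s. bisim s' t'"
    and tu: "\<forall>t' \<in> children t. \<exists>u' \<in> children u. bisim t' u'"
      "\<forall>u' \<in> children u. \<exists>t' \<in> children t. bisim t' u'"
    using 1(2,3) bisim_iff by blast+
  show ?case
    by (subst bisim_iff) (use st tu 1(1) in meson)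
qed

quotient_type 'u hset = "'u tree" / bisim
  by (intro equivpI reflpI sympI transpI) (blast intro: bisim_refl bisim_sym bisim_trans)+

definition elts :: "'u hset \<Rightarrow> 'u hset set" where
  "elts x = abs_hset ` children (rep_hset x)"

definition mem_rel :: "('u hset \<times> 'u hset) set" where
  "mem_rel = {(y, x). y \<in> elts x}"

lemma abs_hset_eq_iff: "abs_hset s = abs_hset t \<longleftrightarrow> bisim s t"
  by (rule hset.abs_eq_iff)

lemma elts_abs_hset: "elts (abs_hset t) = abs_hset ` children t"
proof -
  have "bisim (rep_hset (abs_hset t)) t"
    by (metis abs_hset_eq_iff Quotient3_abs_rep[OF Quotient3_hset])
  then have "\<forall>s' \<in> children (rep_hset (abs_hset t)). \<exists>t' \<in> children t. bisim s' t'"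
      "\<forall>t' \<in> children t. \<exists>s' \<in> children (rep_hset (abs_hset t)). bisim s' t'"
    using bisim_iff by blast+
  then have "\<forall>s' \<in> children (rep_hset (abs_hset t)). \<exists>t' \<in> children t. abs_hset s' = abs_hset t'"
      "\<forall>t' \<in> children t. \<exists>s' \<in> children (rep_hset (abs_hset t)). abs_hset s' = abs_hset t'"
    by (simp_all only: abs_hset_eq_iff)
  then have "abs_hset ` children (rep_hset (abs_hset t)) \<subseteq> abs_hset ` children t"
      "abs_hset ` children t \<subseteq> abs_hset ` children (rep_hset (abs_hset t))"
    by (simp_all add: image_subset_iff image_iff) metis
  then show ?thesis
    unfolding elts_def by (rule subset_antisym)
qed

lemma hset_ext: "elts x = elts y \<Longrightarrow> x = y"
proof -
  assume eq: "elts x = elts y"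
  obtain s t where x: "x = abs_hset s" and y: "y = abs_hset t"
    by (metis Quotient3_abs_rep[OF Quotient3_hset])
  have eq': "abs_hset ` children s = abs_hset ` children t"
    using eq x y elts_abs_hset by metis
  have "bisim s t"
  proof (subst bisim_iff, intro conjI ballI)
    fix s' assume "s' \<in> children s"
    then have "abs_hset s' \<in> abs_hset ` children t" using eq' by blast
    then show "\<exists>t' \<in> children t. bisim s' t'" by (auto simp: abs_hset_eq_iff)
  next
    fix t' assume "t' \<in> children t"
    then have "abs_hset t' \<in> abs_hset ` children s" using eq' by blast
    then show "\<exists>s' \<in> children s. bisim s' t'" by (metis abs_hset_eq_iff imageE)
  qed
  then show "x = y" by (simp add: x y abs_hset_eq_iff)
qed

lemma wf_mem_rel: "wf mem_rel"
proof (rule wfUNIVI)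
  fix P :: "'a hset \<Rightarrow> bool" and x
  assume "\<forall>x. (\<forall>y. (y, x) \<in> mem_rel \<longrightarrow> P y) \<longrightarrow> P x"
  then have step: "(\<And>y. y \<in> elts x \<Longrightarrow> P y) \<Longrightarrow> P x" for x
    by (simp add: mem_rel_def)
  have "P (abs_hset t)" for t
  proof (induction t rule: children_induct)
    case (1 t)
    show ?case
    proof (rule step)
      fix y assume "y \<in> elts (abs_hset t)"
      then show "P y" using 1 by (auto simp: elts_abs_hset)
    qed
  qed
  then show "P x" by (metis Quotient3_abs_rep[OF Quotient3_hset])
qed

text \<open>Every subset of the universe of cardinality at most \<open>\<kappa>\<close>, and no other, is a set.\<close>

lemma small_iff_set: "(\<exists>x. elts x = A) \<longleftrightarrow> |A| \<le>o |UNIV :: ('u + nat) set|"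
  for A :: "'u hset set"
proof
  assume "\<exists>x. elts x = A"
  then obtain x where A: "A = abs_hset ` children (rep_hset x)" by (auto simp: elts_def)
  obtain f where "rep_hset x = Tree f" by (cases "rep_hset x")
  then have "A = (\<lambda>i. abs_hset (the (f i))) ` {i. f i \<noteq> None}"
    using A by (force simp: image_iff)
  then show "|A| \<le>o |UNIV :: ('u + nat) set|"
    by (metis card_of_image card_of_mono1 ordLeq_transitive subset_UNIV)
next
  assume "|A| \<le>o |UNIV :: ('u + nat) set|"
  then obtain g :: "'u hset \<Rightarrow> 'u + nat" where g: "inj_on g A"
    by (meson card_of_ordLeq)
  define f where "f i = (if i \<in> g ` A then Some (rep_hset (inv_into A g i)) else None)" for i
  have "children (Tree f) = rep_hset ` A"
  proof (intro Set.set_eqI iffI)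
    fix t assume "t \<in> children (Tree f)"
    then obtain i where "f i = Some t" by auto
    then obtain a where "a \<in> A" "t = rep_hset (inv_into A g (g a))"
      by (auto simp: f_def split: if_splits)
    then show "t \<in> rep_hset ` A" using g by simp
  next
    fix t assume "t \<in> rep_hset ` A"
    then obtain a where "a \<in> A" "t = rep_hset a" by blast
    then have "f (g a) = Some t" using g by (simp add: f_def)
    then show "t \<in> children (Tree f)" by auto
  qed
  then have "elts (abs_hset (Tree f)) = A"
    by (simp add: elts_abs_hset image_image Quotient3_abs_rep[OF Quotient3_hset])
  then show "\<exists>x. elts x = A" by blast
qed

definition hset_of :: "'u hset set \<Rightarrow> 'u hset" where
  "hset_of A = (THE x. elts x = A)"

lemma elts_hset_of:
  fixes A :: "'u hset set"
  assumes "|A| \<le>o |UNIV :: ('u + nat) set|"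
  shows "elts (hset_of A) = A"
proof -
  have "\<exists>!x. elts x = A" using assms small_iff_set hset_ext by metis
  then show ?thesis unfolding hset_of_def by (rule theI')
qed

lemma elts_hset_of_countable:
  fixes A :: "'u hset set"
  assumes "countable A"
  shows "elts (hset_of A) = A"
proof (rule elts_hset_of)
  have "inj_on (Inr \<circ> to_nat_on A :: 'u hset \<Rightarrow> 'u + nat) A"
    using assms by (intro comp_inj_on inj_on_to_nat_on) auto
  then show "|A| \<le>o |UNIV :: ('u + nat) set|"
    using card_of_ordLeq by blast
qed

definition hpair :: "'u hset \<Rightarrow> 'u hset \<Rightarrow> 'u hset" where
  "hpair x y = hset_of {hset_of {x}, hset_of {x, y}}"

lemma hpair_inject: "hpair x y = hpair x' y' \<longleftrightarrow> x = x' \<and> y = y'"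
proof
  have E: "elts (hset_of {a}) = {a}" "elts (hset_of {a, b}) = {a, b}" for a b :: "'a hset"
    by (simp_all add: elts_hset_of_countable)
  assume "hpair x y = hpair x' y'"
  then have "elts (hpair x y) = elts (hpair x' y')"
    by (rule arg_cong)
  then have "{hset_of {x}, hset_of {x, y}} = {hset_of {x'}, hset_of {x', y'}}"
    unfolding hpair_def E .
  then have "elts ` {hset_of {x}, hset_of {x, y}} = elts ` {hset_of {x'}, hset_of {x', y'}}"
    by (rule arg_cong)
  then have "{{x}, {x, y}} = {{x'}, {x', y'}}"
    unfolding image_insert image_empty E .
  then show "x = x' \<and> y = y'"
    by (metis doubleton_eq_iff insert_absorb2)
qed auto

definition hfst :: "'u hset \<Rightarrow> 'u hset" where
  "hfst z = (THE x. \<exists>y. z = hpair x y)"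

definition hsnd :: "'u hset \<Rightarrow> 'u hset" where
  "hsnd z = (THE y. \<exists>x. z = hpair x y)"

lemma hfst_hpair [simp]: "hfst (hpair x y) = x"
  and hsnd_hpair [simp]: "hsnd (hpair x y) = y"
  by (auto simp: hfst_def hsnd_def hpair_inject)

definition pairs :: "'u hset \<Rightarrow> ('u hset \<times> 'u hset) set" where
  "pairs x = {(y, z). hpair y z \<in> elts x}"

definition tc :: "'u hset \<Rightarrow> 'u hset set" where
  "tc x = {y. (y, x) \<in> mem_rel\<^sup>+}"

lemma pairs_mem_rel: "(y, b) \<in> pairs x \<Longrightarrow> (y, x) \<in> mem_rel\<^sup>+"
proof -
  assume "(y, b) \<in> pairs x"
  then have "(hpair y b, x) \<in> mem_rel" by (simp add: pairs_def mem_rel_def)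
  moreover have "(hset_of {y}, hpair y b) \<in> mem_rel" "(y, hset_of {y}) \<in> mem_rel"
    by (simp_all add: mem_rel_def hpair_def elts_hset_of_countable)
  ultimately show ?thesis by (meson trancl.intros)
qed

definition Ord :: "'u hset \<Rightarrow> bool" where
  "Ord x \<longleftrightarrow> (\<forall>y \<in> elts x. elts y \<subseteq> elts x) \<and> (\<forall>y \<in> elts x. \<forall>z \<in> elts y. elts z \<subseteq> elts y)"

text \<open>The set of countable ordinals. It exists as soon as \<open>\<kappa> \<ge> \<aleph>\<^sub>1\<close>, which will be the case
  wherever it is used.\<close>

definition omega1 :: "'u hset" where
  "omega1 = hset_of {\<alpha>. Ord \<alpha> \<and> countable (elts \<alpha>)}"

text \<open>Infinite cardinals \<open>\<theta> \<le> |'u|\<close> are represented by cardinal orders on subsets of \<open>'u\<close>.\<close>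

definition H :: "'u rel \<Rightarrow> 'u hset set" where
  "H \<theta> = {x. |tc x| <o \<theta>}"


section \<open>Formulas of set theory and elementary submodels\<close>

datatype fm = Mem nat nat | Eq nat nat | Neg fm | Conj fm fm | All nat fm

primrec sat :: "'u hset set \<Rightarrow> fm \<Rightarrow> (nat \<Rightarrow> 'u hset) \<Rightarrow> bool" where
  "sat M (Mem i j) e \<longleftrightarrow> e i \<in> elts (e j)"
| "sat M (Eq i j) e \<longleftrightarrow> e i = e j"
| "sat M (Neg \<phi>) e \<longleftrightarrow> \<not> sat M \<phi> e"
| "sat M (Conj \<phi> \<psi>) e \<longleftrightarrow> sat M \<phi> e \<and> sat M \<psi> e"
| "sat M (All i \<phi>) e \<longleftrightarrow> (\<forall>x \<in> M. sat M \<phi> (e(i := x)))"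

definition elementary_submodel :: "'u hset set \<Rightarrow> 'u hset set \<Rightarrow> bool" where
  "elementary_submodel N M \<longleftrightarrow>
     N \<subseteq> M \<and> (\<forall>\<phi> e. range e \<subseteq> N \<longrightarrow> (sat N \<phi> e \<longleftrightarrow> sat M \<phi> e))"

definition club :: "'a set \<Rightarrow> 'a set set \<Rightarrow> bool" where
  "club X C \<longleftrightarrow>
     (\<forall>N \<in> C. N \<subseteq> X \<and> countable N) \<and>
     (\<forall>A. A \<subseteq> X \<and> countable A \<longrightarrow> (\<exists>N \<in> C. A \<subseteq> N)) \<and>
     (\<forall>F :: nat \<Rightarrow> 'a set. (\<forall>n. F n \<in> C \<and> F n \<subseteq> F (Suc n)) \<longrightarrow> (\<Union>n. F n) \<in> C)"


section \<open>Complete Boolean algebras and the cut and choose game\<close>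

text \<open>The type class \<open>complete_boolean_algebra\<close> of Main demands complete distributivity, so it
  admits atomic algebras only. Only finite distributivity is required here.\<close>

definition complete_BA :: "('a, 'm) gorder_scheme \<Rightarrow> bool" where
  "complete_BA L \<longleftrightarrow> complete_lattice L \<and>
     (\<forall>x \<in> carrier L. \<forall>y \<in> carrier L. \<forall>z \<in> carrier L.
        x \<sqinter>\<^bsub>L\<^esub> (y \<squnion>\<^bsub>L\<^esub> z) = (x \<sqinter>\<^bsub>L\<^esub> y) \<squnion>\<^bsub>L\<^esub> (x \<sqinter>\<^bsub>L\<^esub> z)) \<and>
     (\<forall>x \<in> carrier L. \<exists>y \<in> carrier L. x \<sqinter>\<^bsub>L\<^esub> y = \<bottom>\<^bsub>L\<^esub> \<and> x \<squnion>\<^bsub>L\<^esub> y = \<top>\<^bsub>L\<^esub>)"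

definition compl :: "('a, 'm) gorder_scheme \<Rightarrow> 'a \<Rightarrow> 'a" where
  "compl L x = (THE y. y \<in> carrier L \<and> x \<sqinter>\<^bsub>L\<^esub> y = \<bottom>\<^bsub>L\<^esub> \<and> x \<squnion>\<^bsub>L\<^esub> y = \<top>\<^bsub>L\<^esub>)"

definition implies :: "('a, 'm) gorder_scheme \<Rightarrow> 'a \<Rightarrow> 'a \<Rightarrow> 'a" where
  "implies L x y = compl L x \<squnion>\<^bsub>L\<^esub> y"

text \<open>A strategy for player II receives \<open>p\<close>, the completed rounds \<open>(b\<^sub>i, r\<^sub>i)\<close> and the current
  move \<open>b\<^sub>n\<close> of player I. The answers 1 and 0 are \<^const>\<open>True\<close> and \<^const>\<open>False\<close>.\<close>

type_synonym 'a strategy = "'a \<Rightarrow> ('a \<times> bool) list \<Rightarrow> 'a \<Rightarrow> bool"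

definition II_wins_run :: "('a, 'm) gorder_scheme \<Rightarrow> 'a \<Rightarrow> (nat \<Rightarrow> 'a) \<Rightarrow> (nat \<Rightarrow> bool) \<Rightarrow> bool" where
  "II_wins_run L p b r \<longleftrightarrow>
     p \<sqinter>\<^bsub>L\<^esub> (\<Sqinter>\<^bsub>L\<^esub> {b i | i. r i}) \<sqinter>\<^bsub>L\<^esub> compl L (\<Squnion>\<^bsub>L\<^esub> {b i | i. \<not> r i}) \<noteq> \<bottom>\<^bsub>L\<^esub>"

definition winning_strategy_II :: "('a, 'm) gorder_scheme \<Rightarrow> 'a strategy \<Rightarrow> bool" where
  "winning_strategy_II L \<sigma> \<longleftrightarrow>
     (\<forall>p b r. p \<in> carrier L \<and> p \<noteq> \<bottom>\<^bsub>L\<^esub> \<and> (\<forall>n. b n \<in> carrier L) \<and>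
        (\<forall>n. r n = \<sigma> p (map (\<lambda>i. (b i, r i)) [0..<n]) (b n)) \<longrightarrow> II_wins_run L p b r)"


section \<open>Boolean-valued forcing\<close>

inductive name :: "'u hset gorder \<Rightarrow> 'u hset \<Rightarrow> bool" for L where
  nameI: "(\<And>z. z \<in> elts x \<Longrightarrow> \<exists>y b. z = hpair y b \<and> name L y \<and> b \<in> carrier L) \<Longrightarrow> name L x"

text \<open>The Boolean value of \<open>x = y\<close>, with the values of \<open>z \<in> y\<close> and \<open>w \<in> x\<close> for \<open>z\<close> in the domain
  of \<open>x\<close> and \<open>w\<close> in the domain of \<open>y\<close> unfolded.\<close>

function bval_eq :: "'u hset gorder \<Rightarrow> 'u hset \<Rightarrow> 'u hset \<Rightarrow> 'u hset" where
  "bval_eq L x y =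
     (\<Sqinter>\<^bsub>L\<^esub> ((\<lambda>(z, b). implies L b (\<Squnion>\<^bsub>L\<^esub> ((\<lambda>(w, c). c \<sqinter>\<^bsub>L\<^esub> bval_eq L z w) ` pairs y))) ` pairs x))
     \<sqinter>\<^bsub>L\<^esub>
     (\<Sqinter>\<^bsub>L\<^esub> ((\<lambda>(w, c). implies L c (\<Squnion>\<^bsub>L\<^esub> ((\<lambda>(z, b). b \<sqinter>\<^bsub>L\<^esub> bval_eq L z w) ` pairs x))) ` pairs y))"
  by pat_completeness auto
termination
proof (relation "inv_image (mem_rel\<^sup>+) (\<lambda>(L, x, y). x)", goal_cases)
  case 1
  show ?case by (intro wf_inv_image wf_trancl wf_mem_rel)
next
  case (2 L x y u z b v w c)
  then have "(z, b) \<in> pairs x" by simp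
  then show ?case using pairs_mem_rel by simp
next
  case (3 L x y v w c u z b)
  then have "(z, b) \<in> pairs x" by simp
  then show ?case using pairs_mem_rel by simp
qed

declare bval_eq.simps [simp del]

definition bval_mem :: "'u hset gorder \<Rightarrow> 'u hset \<Rightarrow> 'u hset \<Rightarrow> 'u hset" where
  "bval_mem L x y = \<Squnion>\<^bsub>L\<^esub> ((\<lambda>(w, c). c \<sqinter>\<^bsub>L\<^esub> bval_eq L x w) ` pairs y)"

primrec bval :: "'u hset gorder \<Rightarrow> fm \<Rightarrow> (nat \<Rightarrow> 'u hset) \<Rightarrow> 'u hset" where
  "bval L (Mem i j) e = bval_mem L (e i) (e j)"
| "bval L (Eq i j) e = bval_eq L (e i) (e j)"
| "bval L (Neg \<phi>) e = compl L (bval L \<phi> e)"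
| "bval L (Conj \<phi> \<psi>) e = bval L \<phi> e \<sqinter>\<^bsub>L\<^esub> bval L \<psi> e"
| "bval L (All i \<phi>) e = \<Sqinter>\<^bsub>L\<^esub> {bval L \<phi> (e(i := x)) | x. name L x}"

definition forces :: "'u hset gorder \<Rightarrow> 'u hset \<Rightarrow> fm \<Rightarrow> (nat \<Rightarrow> 'u hset) \<Rightarrow> bool" where
  "forces L q \<phi> e \<longleftrightarrow> q \<sqsubseteq>\<^bsub>L\<^esub> bval L \<phi> e"

function check_name :: "'u hset gorder \<Rightarrow> 'u hset \<Rightarrow> 'u hset" where
  "check_name L x = hset_of ((\<lambda>y. hpair (check_name L y) \<top>\<^bsub>L\<^esub>) ` elts x)"
  by pat_completeness auto
termination
proof (relation "inv_image mem_rel snd", goal_cases)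
  case 1
  show ?case by (intro wf_inv_image wf_mem_rel)
next
  case (2 L x y)
  then show ?case by (simp add: mem_rel_def)
qed

declare check_name.simps [simp del]

text \<open>The canonical name for \<open>N[G]\<close>, the set of evaluations of the names in \<open>N\<close>.\<close>

definition extension_name :: "'u hset gorder \<Rightarrow> 'u hset set \<Rightarrow> 'u hset" where
  "extension_name L N = hset_of {hpair x \<top>\<^bsub>L\<^esub> | x. x \<in> N \<and> name L x}"

text \<open>The formula \<open>x\<^sub>0 \<inter> x\<^sub>1 = x\<^sub>2\<close>.\<close>

definition Iff :: "fm \<Rightarrow> fm \<Rightarrow> fm" where
  "Iff \<phi> \<psi> = Conj (Neg (Conj \<phi> (Neg \<psi>))) (Neg (Conj \<psi> (Neg \<phi>)))"

definition inter_eq_fm :: fm where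
  "inter_eq_fm = All 3 (Iff (Conj (Mem 3 0) (Mem 3 1)) (Mem 3 2))"

definition forces_same_omega1 :: "'u hset gorder \<Rightarrow> 'u hset \<Rightarrow> 'u hset set \<Rightarrow> bool" where
  "forces_same_omega1 L q N \<longleftrightarrow>
     forces L q inter_eq_fm
       (\<lambda>i. if i = 0 then extension_name L N
            else if i = 1 then check_name L omega1
            else check_name L (hset_of (N \<inter> elts omega1)))"


section \<open>Semiproperness\<close>

text \<open>A Boolean algebra in the universe is the pair of its carrier and its order relation.\<close>

definition alg :: "'u hset \<Rightarrow> 'u hset gorder" where
  "alg B = \<lparr>carrier = elts (hfst B), eq = (=), le = (\<lambda>x y. hpair x y \<in> elts (hsnd B))\<rparr>"

definition is_complete_BA :: "'u hset \<Rightarrow> bool" where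
  "is_complete_BA B \<longleftrightarrow>
     (\<exists>C R. B = hpair C R \<and> elts R \<subseteq> {hpair x y | x y. x \<in> elts C \<and> y \<in> elts C}) \<and>
     complete_BA (alg B)"

text \<open>A threshold for ``sufficiently large'' has to depend on \<open>B\<close> alone, not on the size of the
  universe: an existential quantifier over thresholds in \<^typ>\<open>'u rel\<close> could be met by choosing one
  above which the universe has no cardinals. We take \<open>\<theta> > 2\<^bsup>max |tc B| \<aleph>\<^sub>0\<^esup>\<close>, which
  puts \<open>B\<close>, the power set of its carrier and \<open>\<omega>\<^sub>1\<close> into \<open>H \<theta>\<close>. Such \<open>\<theta>\<close> exist as orders on
  \<open>'u\<close> once \<open>'u\<close> is large, and a statement for all \<open>'u\<close> covers every regular \<open>\<theta>\<close> above
  the threshold.\<close>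

definition large_for :: "'u hset \<Rightarrow> 'u rel \<Rightarrow> bool" where
  "large_for B \<theta> \<longleftrightarrow> |Pow (tc B <+> (UNIV :: nat set))| <o \<theta>"

definition semiproper :: "'u hset \<Rightarrow> bool" where
  "semiproper B \<longleftrightarrow>
     (\<forall>\<theta> :: 'u rel. Cinfinite \<theta> \<and> regularCard \<theta> \<and> large_for B \<theta> \<longrightarrow>
        (\<exists>\<C>. club (H \<theta>) \<C> \<and>
           (\<forall>N \<in> \<C>. elementary_submodel N (H \<theta>) \<and> B \<in> N \<and>
              (\<forall>p \<in> N \<inter> carrier (alg B). p \<noteq> \<bottom>\<^bsub>alg B\<^esub> \<longrightarrow>
                 (\<exists>q \<in> carrier (alg B). q \<noteq> \<bottom>\<^bsub>alg B\<^esub> \<and> q \<sqsubseteq>\<^bsub>alg B\<^esub> p \<and>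
                    forces_same_omega1 (alg B) q N)))))"

end

theory Submission
  imports Defs
begin

text \<open>
  Let \<open>x\<close> be a name for a countable ordinal and let II follow a winning strategy. After any
  position, some continuation ends with a question ``is \<open>x\<close> in \<open>U\<close>?'', for a countable set \<open>U\<close> of
  ordinals, that is answered by ``yes''. Otherwise code \<open>x\<close> by a real that describes a well-order of
  \<open>\<omega>\<close> of type \<open>x\<close>, and let I ask for bits of the code. Since all countable sets are refused,
  so is each singleton, and the codes of the ordinals that result from these runs branch at every
  position. On the other hand a boundedness argument applies: every run is won by II, so it
  describes a genuine well-order, and the ranks in the countable tree of positions bound all the
  resulting ordinals by one countable ordinal. A run that diagonalises against the ordinals up to
  this bound is a contradiction.

  Now let \<open>N\<close> be closed under the countable sets \<open>U\<close> obtained in this way from finite sequences in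
  \<open>N\<close>. For \<open>p \<in> N\<close>, a run that treats all names in \<open>N\<close> in turn yields a condition \<open>q \<le> p\<close> forcing
  each of them, if it denotes a countable ordinal, into a set \<open>U \<subseteq> N\<close>.
\<close>

section \<open>Increasing sequences of finite lists\<close>

text \<open>Merges an increasing sequence of positions into one infinite run of cuts.\<close>

lemma list_chain_limit:
  fixes l :: "nat \<Rightarrow> 'a list"
  assumes "\<And>n. \<exists>vs. vs \<noteq> [] \<and> l (Suc n) = l n @ vs"
  obtains f where "\<And>n. map f [0..<length (l n)] = l n" and "\<And>n. n \<le> length (l n)"
proof -
  have len: "n \<le> length (l n)" for n
  proof (induction n)
    case (Suc n)
    obtain vs where "vs \<noteq> []" "l (Suc n) = l n @ vs"
      using assms by blast
    then show ?case
      using Suc by (cases vs) auto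
  qed simp
  have ext: "\<exists>vs. l (n + k) = l n @ vs" for n k
  proof (induction k)
    case (Suc k)
    then show ?case
      using assms[of "n + k"] by auto
  qed simp
  \<comment> \<open>The index \<open>Suc i\<close> ensures that there is an entry at place
    \<open>i\<close>.\<close>
  define f where "f i = l (Suc i) ! i" for i
  have "f i = l n ! i" if "i < length (l n)" for i n
  proof (cases "Suc i \<le> n")
    case True
    then obtain vs where "l n = l (Suc i) @ vs"
      using ext[of "Suc i" "n - Suc i"] by auto
    then show ?thesis
      using len[of "Suc i"] by (simp add: f_def nth_append)
  next
    case False
    then obtain vs where "l (Suc i) = l n @ vs"
      using ext[of n "Suc i - n"] by auto
    then show ?thesis
      using that by (simp add: f_def nth_append)
  qed
  then have "map f [0..<length (l n)] = l n" for n
    by (auto intro: nth_equalityI)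
  then show thesis
    using that len by blast
qed

lemma take_map_upt: "j \<le> n \<Longrightarrow> take j (map f [0..<n]) = map f [0..<j]"
  by (simp add: take_map take_upt)


section \<open>Well-orders with countable initial segments\<close>

text \<open>A strict well-order of type at most \<open>\<omega>\<^sub>1\<close>. The intended
  instance is the set of countable ordinals.\<close>

locale countable_segments =
  fixes W :: "'w set" and r :: "'w rel"
  assumes wf_r: "wf r"
    and trans_r: "trans r"
    and total_r: "total_on W r"
    and r_sub: "r \<subseteq> W \<times> W"
    and countable_r: "\<And>a. a \<in> W \<Longrightarrow> countable {b. (b, a) \<in> r}"
begin

section \<open>Codes of points by relations on the natural numbers\<close>

lemma irrefl_r: "(a, a) \<notin> r"
  using wf_r by (simp add: wf_not_refl)

definition enum :: "'w \<Rightarrow> 'w \<Rightarrow> nat" where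
  "enum a = to_nat_on {b. (b, a) \<in> r}"

lemma inj_enum: "a \<in> W \<Longrightarrow> inj_on (enum a) {b. (b, a) \<in> r}"
  unfolding enum_def using countable_r by (rule inj_on_to_nat_on)

lemma enum_eq: "(b, a) \<in> r \<Longrightarrow> (b', a) \<in> r \<Longrightarrow> enum a b = enum a b' \<Longrightarrow> b = b'"
  using inj_enum[of a] r_sub by (auto dest: inj_onD)

text \<open>The order is taken reflexive so that its field is visible; otherwise segments with no
  and with one element would both have the empty code.\<close>

definition code :: "'w \<Rightarrow> (nat \<times> nat) set" where
  "code a = {(enum a b, enum a c) | b c. (b, c) \<in> r\<^sup>= \<and> (c, a) \<in> r \<and> (b, a) \<in> r}"

lemma code_enum:
  assumes "(b, a) \<in> r" "(c, a) \<in> r"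
  shows "(enum a b, enum a c) \<in> code a \<longleftrightarrow> (b, c) \<in> r\<^sup>="
proof
  assume "(enum a b, enum a c) \<in> code a"
  then obtain b' c' where "enum a b = enum a b'" "enum a c = enum a c'" "(b', c') \<in> r\<^sup>="
      "(c', a) \<in> r" "(b', a) \<in> r"
    by (auto simp: code_def)
  then show "(b, c) \<in> r\<^sup>="
    using enum_eq assms by metis
next
  assume "(b, c) \<in> r\<^sup>="
  then show "(enum a b, enum a c) \<in> code a"
    using assms unfolding code_def by blast
qed

lemma code_D:
  assumes "(m, n) \<in> code a"
  obtains b c where "m = enum a b" "n = enum a c" "(b, c) \<in> r\<^sup>=" "(c, a) \<in> r" "(b, a) \<in> r"
  using assms unfolding code_def by blast

text \<open>A common code induces an isomorphism of initial segments, which has to be the identity.\<close>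

lemma code_neq:
  assumes "(a, a') \<in> r"
  shows "code a \<noteq> code a'"
proof
  assume eq: "code a = code a'"
  have fwd: "\<exists>b'. (b', a') \<in> r \<and> enum a b = enum a' b'" if "(b, a) \<in> r" for b
  proof -
    have "(enum a b, enum a b) \<in> code a'"
      using that eq code_enum[of b a b] by simp
    then show ?thesis
      by (auto elim: code_D)
  qed
  have bwd: "\<exists>b. (b, a) \<in> r \<and> enum a b = enum a' b'" if "(b', a') \<in> r" for b'
  proof -
    have "(enum a' b', enum a' b') \<in> code a"
      using that eq code_enum[of b' a' b'] by simp
    then show ?thesis
      by (elim code_D) metis
  qed
  have ident: "(b, a) \<in> r \<longrightarrow> (\<forall>b'. (b', a') \<in> r \<and> enum a b = enum a' b' \<longrightarrow> b = b')" for b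
    using wf_r
  proof (induction b rule: wf_induct_rule)
    case (less b)
    show ?case
    proof (intro impI allI, elim conjE)
      fix b' assume b: "(b, a) \<in> r" and b': "(b', a') \<in> r" and e: "enum a b = enum a' b'"
      have iso: "(c, b) \<in> r\<^sup>= \<longleftrightarrow> (c', b') \<in> r\<^sup>="
        if "(c, a) \<in> r" "(c', a') \<in> r" "enum a c = enum a' c'" for c c'
        using code_enum[OF that(1) b] code_enum[OF that(2) b'] eq that(3) e by simp
      have "c = b' \<or> (c, b') \<in> r" if cb: "(c, b) \<in> r" for c
      proof -
        have ca: "(c, a) \<in> r"
          using cb b trans_r by (meson transD)
        then obtain c' where c': "(c', a') \<in> r" "enum a c = enum a' c'"
          using fwd by blast
        then have "c = c'"
          using less cb ca by blast
        then show ?thesis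
          using iso[OF ca c'] cb by auto
      qed
      \<comment> \<open>By this inclusion, \<open>b\<close> below \<open>b'\<close> would make
        \<open>b\<close> a predecessor of itself.\<close>
      moreover have "(c', b) \<in> r" if cb: "(c', b') \<in> r" for c'
      proof -
        have c'a: "(c', a') \<in> r"
          using cb b' trans_r by (meson transD)
        then obtain c where c: "(c, a) \<in> r" "enum a c = enum a' c'"
          using bwd by blast
        then have "(c, b) \<in> r\<^sup>="
          using iso[OF c(1) c'a c(2)] cb by simp
        moreover have "c \<noteq> b"
          using c e enum_eq[OF b' c'a] cb irrefl_r by auto
        ultimately have "(c, b) \<in> r"
          by simp
        then show ?thesis
          using less c c'a by blast
      qed
      moreover have "b \<in> W" "b' \<in> W"
        using b b' r_sub by auto
      \<comment> \<open>If \<open>b'\<close> were below \<open>b\<close>, it would be its own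
        counterpart by the induction hypothesis, so \<open>enum a\<close> would give
        \<open>b\<close> and \<open>b'\<close> the same number.\<close>
      moreover have "(b', b) \<notin> r"
      proof
        assume b'b: "(b', b) \<in> r"
        then have "(b', a) \<in> r"
          using b trans_r by (meson transD)
        then obtain d where d: "(d, a') \<in> r" "enum a b' = enum a' d"
          using fwd by blast
        then have "b' = d"
          using less b'b \<open>(b', a) \<in> r\<close> by blast
        then have "enum a b' = enum a b"
          using d e by simp
        then show False
          using enum_eq[OF \<open>(b', a) \<in> r\<close> b] b'b irrefl_r by simp
      qed
      ultimately show "b = b'"
        using total_r irrefl_r unfolding total_on_def by blast
    qed
  qed
  \<comment> \<open>The point \<open>a\<close> lies in the longer segment, so it has a counterpart
    below \<open>a\<close>, which \<open>ident\<close> identifies with \<open>a\<close>.\<close>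
  obtain b where "(b, a) \<in> r" "enum a b = enum a' a"
    using bwd assms by blast
  then show False
    using ident assms irrefl_r by blast
qed

lemma inj_code: "inj_on code W"
  using code_neq total_r by (metis inj_onI total_on_def)

lemma card_le_continuum: "|W| \<le>o |UNIV :: (nat \<times> nat) set set|"
  using inj_code card_of_ordLeq by blast

text \<open>This is the regularity of \<open>\<omega>\<^sub>1\<close>: a countable set and the
  predecessors of its points are jointly countable, and any point left over lies above all of
  \<open>A\<close>.\<close>

lemma countable_bounded:
  assumes "uncountable W" "countable A" "A \<subseteq> W"
  shows "\<exists>b \<in> W. \<forall>a \<in> A. (a, b) \<in> r"
proof -
  have "countable (\<Union>a \<in> A. insert a {b. (b, a) \<in> r})"
    using assms countable_r by (intro countable_UN) auto
  then have "\<not> W \<subseteq> (\<Union>a \<in> A. insert a {b. (b, a) \<in> r})"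
    using assms(1) countable_subset by blast
  then obtain b where "b \<in> W" "\<And>a. a \<in> A \<Longrightarrow> b \<noteq> a \<and> (b, a) \<notin> r"
    by auto
  then show ?thesis
    using total_r assms(3) unfolding total_on_def by blast
qed

text \<open>Recursion along \<open>R\<close> always finds a value above the countably many earlier
  ones.\<close>

lemma rank_exists:
  assumes "uncountable W" "wf R" "\<And>y. countable {x. (x, y) \<in> R}"
  shows "\<exists>\<rho>. range \<rho> \<subseteq> W \<and> (\<forall>x y. (x, y) \<in> R \<longrightarrow> (\<rho> x, \<rho> y) \<in> r)"
proof -
  define F where "F g y = (SOME w. w \<in> W \<and> (\<forall>x. (x, y) \<in> R \<longrightarrow> (g x, w) \<in> r))" for g y
  define \<rho> where "\<rho> = wfrec R F"
  have rho: "\<rho> y = F \<rho> y" for y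
  proof -
    \<comment> \<open>\<open>F\<close> consults its argument at \<open>R\<close>-predecessors of
      \<open>y\<close> only, so the truncation made by \<open>wfrec\<close> has no effect.\<close>
    have "F (cut \<rho> R y) y = F \<rho> y"
      unfolding F_def by (simp add: cut_def cong: conj_cong imp_cong)
    then show ?thesis
      unfolding \<rho>_def using wfrec[OF assms(2)] by metis
  qed
  have "\<rho> y \<in> W \<and> (\<forall>x. (x, y) \<in> R \<longrightarrow> (\<rho> x, \<rho> y) \<in> r)" for y
    using assms(2)
  proof (induction y rule: wf_induct_rule)
    case (less y)
    have "\<exists>b \<in> W. \<forall>a \<in> \<rho> ` {x. (x, y) \<in> R}. (a, b) \<in> r"
      using less assms by (intro countable_bounded) auto
    then have "\<exists>w. w \<in> W \<and> (\<forall>x. (x, y) \<in> R \<longrightarrow> (\<rho> x, w) \<in> r)"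
      by auto
    then show ?case
      unfolding rho[of y] F_def by (rule someI_ex)
  qed
  then show ?thesis
    by blast
qed

text \<open>Cut and choose on the subsets of \<open>W\<close>: \<open>A qs U\<close> is the answer to \<open>U\<close> after the cuts \<open>qs\<close>.
  The cuts made below are the bits of the code of the hidden point and singletons
  \<open>{v qs}\<close>, where \<open>v qs\<close> is a point that results from \<open>qs\<close> by asking all bits.
  If all singletons were answered negatively, the countably many positions \<open>Q\<close> so generated would
  admit runs that avoid any given countable set of points. But as no run produces a code of an
  ill-founded relation, the ranks of \<open>Q\<close> bound the results of all these runs.\<close>

theorem countable_cut_accepted:
  assumes run: "\<And>f. (\<And>n. f n \<subseteq> W) \<Longrightarrow>
      \<exists>a \<in> W. \<forall>n. A (map f [0..<n]) (f n) \<longleftrightarrow> a \<in> f n"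
  shows "\<exists>qs U. set qs \<subseteq> Pow W \<and> U \<subseteq> W \<and> countable U \<and> A qs U"
proof (rule ccontr)
  assume "\<not> ?thesis"
  then have no: "\<not> A qs U" if "set qs \<subseteq> Pow W" "U \<subseteq> W" "countable U" for qs U
    using that by blast
  \<comment> \<open>Some point of \<open>W\<close> agrees with the run that always asks for
    \<open>W\<close>, so \<open>W\<close> is accepted and cannot be countable.\<close>
  have unc: "uncountable W"
  proof
    assume "countable W"
    then have "\<not> A [] W"
      using no[of "[]" W] by simp
    moreover have "\<exists>a \<in> W. \<forall>n. A (map (\<lambda>_. W) [0..<n]) W \<longleftrightarrow> a \<in> W"
      by (rule run) simp
    ultimately show False
      by (auto dest: spec[of _ 0])
  qed
  define K where "K z = {a \<in> W. z \<in> code a}" for z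
  have KW: "K z \<subseteq> W" for z
    by (auto simp: K_def)
  \<comment> \<open>After \<open>qs\<close> all bits of the code are asked in turn;
    \<open>v qs\<close> is a point that agrees with all answers in this run.\<close>
  define g where "g qs i = (if i < length qs then qs ! i else K (prod_decode (i - length qs)))"
    for qs i
  define v where "v qs = (SOME a. a \<in> W \<and> (\<forall>n. A (map (g qs) [0..<n]) (g qs n) \<longleftrightarrow> a \<in> g qs n))"
    for qs
  have v: "v qs \<in> W" "\<And>n. A (map (g qs) [0..<n]) (g qs n) \<longleftrightarrow> v qs \<in> g qs n"
    if "set qs \<subseteq> Pow W" for qs
  proof -
    have "g qs n \<subseteq> W" for n
    proof (cases "n < length qs")
      case True
      then show ?thesis
        using subsetD[OF that nth_mem[OF True]] by (simp add: g_def)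
    qed (simp add: g_def KW)
    from run[OF this] have "\<exists>a. a \<in> W \<and> (\<forall>n. A (map (g qs) [0..<n]) (g qs n) \<longleftrightarrow> a \<in> g qs n)"
      by (simp only: Bex_def)
    from someI_ex[OF this, folded v_def] show "v qs \<in> W"
        "\<And>n. A (map (g qs) [0..<n]) (g qs n) \<longleftrightarrow> v qs \<in> g qs n"
      by simp_all
  qed
  \<comment> \<open>\<open>None\<close> asks for the singleton of \<open>v qs\<close>,
    \<open>Some z\<close> for the bit \<open>z\<close>. These instructions form a countable type, so
    \<open>Q\<close> is countable.\<close>
  define ext where "ext qs z = qs @ [case z of None \<Rightarrow> {v qs} | Some z \<Rightarrow> K z]" for qs z
  define Q where "Q = range (foldl ext [])"
  have Qc: "countable Q"
    unfolding Q_def by simp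
  have Q_ext: "foldl ext qs zs \<in> Q" if "qs \<in> Q" for qs zs
    using that unfolding Q_def by (metis foldl_append imageE rangeI)
  have QW: "set qs \<subseteq> Pow W" if "qs \<in> Q" for qs
  proof -
    have "set (foldl ext [] zs) \<subseteq> Pow W" for zs
    proof (induction zs rule: rev_induct)
      case (snoc z zs)
      then show ?case
        using v(1)[of "foldl ext [] zs"] KW
        by (simp add: ext_def[of "foldl ext [] zs"] split: option.splits)
    qed simp
    then show ?thesis
      using that unfolding Q_def by (elim imageE) simp
  qed
  \<comment> \<open>Going down in \<open>R\<close> extends the position up to an accepted bit
    \<open>(n', n)\<close>, which declares \<open>n'\<close> to be below \<open>n\<close>. As codes
    are reflexive, \<open>n' \<noteq> n\<close> is demanded separately.\<close>
  define R where "R = {((qs', n'), (qs, n)). qs' \<in> Q \<and> n' \<noteq> n \<and>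
      (\<exists>vs. qs' = qs @ vs @ [K (n', n)] \<and> A (qs @ vs) (K (n', n)))}"
  \<comment> \<open>A descending sequence in \<open>R\<close> unites to one run whose accepted bits
    describe a descending sequence of numbers. But the point agreeing with that run has the code of
    a well-order.\<close>
  have "wf R"
    unfolding wf_iff_no_infinite_down_chain
  proof
    assume "\<exists>s. \<forall>i. (s (Suc i), s i) \<in> R"
    then obtain s where s: "\<And>i. (s (Suc i), s i) \<in> R"
      by blast
    define l n where "l i = fst (s i)" and "n i = snd (s i)" for i
    have ln: "l (Suc i) \<in> Q" "n (Suc i) \<noteq> n i"
        "\<exists>vs. l (Suc i) = l i @ vs @ [K (n (Suc i), n i)] \<and> A (l i @ vs) (K (n (Suc i), n i))" for i
      using s[of i] unfolding R_def l_def n_def by (auto simp: case_prod_unfold)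
    have "\<exists>vs. vs \<noteq> [] \<and> l (Suc i) = l i @ vs" for i
      using ln(3)[of i] by auto
    then obtain f where f: "\<And>i. map f [0..<length (l i)] = l i" "\<And>i. i \<le> length (l i)"
      using list_chain_limit by metis
    have fW: "f i \<subseteq> W" for i
    proof -
      have "f i \<in> set (map f [0..<length (l (Suc i))])"
        using f(2)[of "Suc i"] by auto
      then have "f i \<in> set (l (Suc i))"
        unfolding f(1) .
      then show ?thesis
        using QW[OF ln(1), of i] by blast
    qed
    obtain a where a: "a \<in> W" "\<And>n. A (map f [0..<n]) (f n) \<longleftrightarrow> a \<in> f n"
      using run[of f, OF fW] by blast
    have code: "(n (Suc i), n i) \<in> code a" for i
    proof -
      obtain vs where vs: "l (Suc i) = l i @ vs @ [K (n (Suc i), n i)]" "A (l i @ vs) (K (n (Suc i), n i))"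
        using ln(3)[of i] by blast
      define k where "k = length (l i @ vs)"
      have len: "length (l (Suc i)) = Suc k"
        by (simp add: vs k_def)
      have "map f [0..<Suc k] = (l i @ vs) @ [K (n (Suc i), n i)]"
        using f(1)[of "Suc i"] unfolding len by (simp add: vs(1))
      then have "map f [0..<k] = l i @ vs" "f k = K (n (Suc i), n i)"
        by (simp_all only: upt_Suc_append le0 map_append list.map append1_eq_conv)
      then show ?thesis
        using a(2)[of k] vs(2) by (simp add: K_def)
    qed
    have "\<exists>b. (b, a) \<in> r \<and> n i = enum a b" for i
      using code[of i] by (auto elim: code_D)
    then obtain b where b: "\<And>i. (b i, a) \<in> r" "\<And>i. n i = enum a (b i)"
      by metis
    have "(b (Suc i), b i) \<in> r" for i
      using code[of i] code_enum[OF b(1) b(1)] ln(2)[of i] by (auto simp: b(2))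
    then show False
      using wf_r unfolding wf_iff_no_infinite_down_chain by blast
  qed
  moreover have "countable {x. (x, y) \<in> R}" for y
    by (rule countable_subset[of _ "Q \<times> UNIV"]) (use Qc in \<open>auto simp: R_def\<close>)
  ultimately obtain \<rho> where \<rho>: "range \<rho> \<subseteq> W" "\<And>x y. (x, y) \<in> R \<Longrightarrow> (\<rho> x, \<rho> y) \<in> r"
    using rank_exists[OF unc] by blast
  \<comment> \<open>One \<open>w\<close> exceeds the ranks of all pairs of a position in
    \<open>Q\<close> and a number. The run built next is to avoid the countable segment
    \<open>D\<close> up to \<open>w\<close>, enumerated by \<open>a\<close>.\<close>
  have "countable (\<rho> ` (Q \<times> UNIV))"
    using Qc by simp
  then obtain w where w: "w \<in> W" "\<And>x. x \<in> Q \<times> UNIV \<Longrightarrow> (\<rho> x, w) \<in> r"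
    using countable_bounded[OF unc] \<rho>(1) by (metis image_eqI image_subset_iff subset_UNIV rangeI)
  define D where "D = insert w {b. (b, w) \<in> r}"
  have D: "countable D" "D \<noteq> {}"
    using countable_r[OF w(1)] by (auto simp: D_def)
  define a where "a = from_nat_into D"
  \<comment> \<open>A continuation within \<open>Q\<close> that contradicts \<open>c\<close> and
    ends with the bit \<open>z\<close>. If \<open>c\<close> is \<open>v qs\<close>, the refused
    singleton contradicts it. Otherwise the codes of \<open>c\<close> and \<open>v qs\<close> differ
    at some bit, whose answer along \<open>g qs\<close> agrees with \<open>v qs\<close>.\<close>
  have step0: "\<exists>zs. zs \<noteq> [] \<and> (\<exists>us. foldl ext qs zs = qs @ us) \<and>
      last (foldl ext qs zs) = K z \<and>
      (\<exists>j < length (foldl ext qs zs). A (take j (foldl ext qs zs)) (foldl ext qs zs ! j) \<noteq>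
         (c \<in> foldl ext qs zs ! j))"
    if qs: "qs \<in> Q" and c: "c \<in> W" for qs z c
  proof (cases "c = v qs")
    case True
    have "\<not> A qs {v qs}"
      using no[of qs "{v qs}"] QW[OF qs] v(1)[of qs] by simp
    then have "A (take (length qs) (foldl ext qs [None, Some z])) (foldl ext qs [None, Some z] ! length qs) \<noteq>
         (c \<in> foldl ext qs [None, Some z] ! length qs)"
      using True by (simp add: ext_def)
    moreover have "last (foldl ext qs [None, Some z]) = K z" "length qs < length (foldl ext qs [None, Some z])"
        "\<exists>us. foldl ext qs [None, Some z] = qs @ us"
      by (simp_all add: ext_def)
    ultimately show ?thesis
      by (metis list.distinct(1))
  next
    case False
    then have "code c \<noteq> code (v qs)"
      using inj_code c v(1)[OF QW[OF qs]] by (auto dest: inj_onD)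
    then obtain y where y: "(y \<in> code c) \<noteq> (y \<in> code (v qs))"
      by blast
    define k where "k = prod_encode y"
    define zs where "zs = map (Some \<circ> prod_decode) [0..<Suc k] @ [Some z]"
    have fold: "foldl ext qs (map (Some \<circ> prod_decode) [0..<m]) = map (g qs) [0..<length qs + m]" for m
    proof (induction m)
      case 0
      show ?case
        by (auto intro: nth_equalityI simp: g_def)
    next
      case (Suc m)
      then show ?case
        by (simp add: ext_def g_def)
    qed
    have eq: "foldl ext qs zs = map (g qs) [0..<length qs + Suc k] @ [K z]"
      unfolding zs_def foldl_append fold by (simp add: ext_def)
    have gk: "g qs (length qs + k) = K y"
      by (simp add: g_def k_def)
    have "A (map (g qs) [0..<length qs + k]) (K y) \<longleftrightarrow> v qs \<in> K y"
      using v(2)[OF QW[OF qs], of "length qs + k"] unfolding gk .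
    moreover have "take (length qs + k) (foldl ext qs zs) = map (g qs) [0..<length qs + k]"
        "foldl ext qs zs ! (length qs + k) = K y"
      unfolding eq by (simp_all add: take_map_upt nth_append gk)
    ultimately have "A (take (length qs + k) (foldl ext qs zs)) (foldl ext qs zs ! (length qs + k)) \<noteq>
         (c \<in> foldl ext qs zs ! (length qs + k))"
      using y c v(1)[OF QW[OF qs]] by (simp add: K_def)
    moreover have "length qs + k < length (foldl ext qs zs)" "last (foldl ext qs zs) = K z" "zs \<noteq> []"
      unfolding eq by (auto simp: zs_def)
    moreover have "\<exists>us. foldl ext qs zs = qs @ us"
    proof -
      have "map (g qs) [0..<length qs] = qs"
        using fold[of 0] by simp
      then show ?thesis
        unfolding eq upt_add_eq_append[OF le0] map_append by simp
    qed
    ultimately show ?thesis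
      by blast
  qed
  have step: "\<exists>us. qs @ us \<in> Q \<and> us \<noteq> [] \<and> last us = K z \<and>
      (\<exists>j < length (qs @ us). A (take j (qs @ us)) ((qs @ us) ! j) \<noteq> (c \<in> (qs @ us) ! j))"
    if "qs \<in> Q" and "c \<in> W" for qs z c
  proof -
    have len: "length (foldl ext qs zs) = length qs + length zs" for zs
      by (induction zs rule: rev_induct) (simp_all add: ext_def)
    from step0[OF that, of z] obtain zs us where *: "zs \<noteq> []" "foldl ext qs zs = qs @ us" "last (foldl ext qs zs) = K z"
      "\<exists>j < length (foldl ext qs zs). A (take j (foldl ext qs zs)) (foldl ext qs zs ! j) \<noteq>
         (c \<in> foldl ext qs zs ! j)"
      by blast
    moreover have "us \<noteq> []"
      using *(1,2) len[of zs] by auto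
    ultimately show ?thesis
      using Q_ext[OF that(1), of zs] by (intro exI[of _ us]) auto
  qed
  \<comment> \<open>Stage \<open>i\<close> contradicts \<open>a i\<close> and ends with a bit that
    depends only on the first component of \<open>prod_decode i\<close>. The second component makes
    every bit recur at arbitrarily late stages.\<close>
  define P where "P i qs qs' \<longleftrightarrow> (\<exists>us. qs' = qs @ us \<and> us \<noteq> [] \<and> last us = K (prod_decode (fst (prod_decode i))) \<and>
      (\<exists>j < length qs'. A (take j qs') (qs' ! j) \<noteq> (a i \<in> qs' ! j)))" for i qs qs'
  have aW: "a i \<in> W" for i
    using from_nat_into[OF D(2), of i] w(1) r_sub by (auto simp: a_def D_def)
  have "\<exists>l. \<forall>i. l i \<in> Q \<and> P i (l i) (l (Suc i))"
  proof (rule dependent_nat_choice)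
    show "\<exists>qs. qs \<in> Q"
      by (auto simp: Q_def)
  next
    fix qs i assume "qs \<in> Q"
    from step[OF this aW[of i], of "prod_decode (fst (prod_decode i))"]
    obtain us where "qs @ us \<in> Q" "P i qs (qs @ us)"
      unfolding P_def by blast
    then show "\<exists>qs'. qs' \<in> Q \<and> P i qs qs'"
      by (intro exI conjI)
  qed
  then obtain l where l: "\<And>i. l i \<in> Q" "\<And>i. P i (l i) (l (Suc i))"
    by blast
  have "\<exists>vs. vs \<noteq> [] \<and> l (Suc i) = l i @ vs" for i
    using l(2)[of i] unfolding P_def by auto
  then obtain f where f: "\<And>i. map f [0..<length (l i)] = l i" "\<And>i. i \<le> length (l i)"
    using list_chain_limit by metis
  have fW: "f i \<subseteq> W" for i
  proof -
    have "f i \<in> set (map f [0..<length (l (Suc i))])"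
      using f(2)[of "Suc i"] by auto
    then have "f i \<in> set (l (Suc i))"
      unfolding f(1) .
    then show ?thesis
      using QW[OF l(1), of "Suc i"] by blast
  qed
  obtain x where x: "x \<in> W" "\<And>n. A (map f [0..<n]) (f n) \<longleftrightarrow> x \<in> f n"
    using run[of f, OF fW] by blast
  have neq: "x \<noteq> a i" for i
  proof
    assume "x = a i"
    obtain j where j: "j < length (l (Suc i))" "A (take j (l (Suc i))) (l (Suc i) ! j) \<noteq> (a i \<in> l (Suc i) ! j)"
      using l(2)[of i] unfolding P_def by blast
    have "take j (l (Suc i)) = map f [0..<j]" "l (Suc i) ! j = f j"
      using j(1) f(1)[of "Suc i"] take_map_upt[of j "length (l (Suc i))" f]
      by (simp, metis nth_map_upt add_0 diff_zero)
    then show False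
      using j(2) x(2) \<open>x = a i\<close> by simp
  qed
  have "x \<in> D"
  proof -
    \<comment> \<open>If \<open>c\<close> is below \<open>b\<close>, the bit saying so is accepted
      at a stage \<open>k \<ge> i\<close>. Then \<open>c\<close> is at most its rank at
      \<open>l (Suc k)\<close>, which is below the rank of \<open>b\<close> at \<open>l i\<close>.
      Hence \<open>b\<close> is at most the latter.\<close>
    have rank: "(b, \<rho> (l i, enum x b)) \<in> r\<^sup>=" if "(b, x) \<in> r" for b i
      using wf_r that
    proof (induction b arbitrary: i rule: wf_induct_rule)
      case (less b)
      have below: "(c, \<rho> (l i, enum x b)) \<in> r" if cb: "(c, b) \<in> r" for c
      proof -
        have cx: "(c, x) \<in> r"
          using cb less.prems trans_r by (meson transD)
        define k where "k = prod_encode (prod_encode (enum x c, enum x b), i)"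
        have "i \<le> k"
          unfolding k_def by (rule le_prod_encode_2)
        have "\<exists>us. l (i + m) = l i @ us" for m
        proof (induction m)
          case (Suc m)
          then show ?case
            using l(2)[of "i + m"] unfolding P_def by auto
        qed simp
        from this[of "k - i"] obtain us where us: "l k = l i @ us"
          using \<open>i \<le> k\<close> by auto
        obtain vs where vs: "l (Suc k) = l k @ vs" "vs \<noteq> []" "last vs = K (enum x c, enum x b)"
          using l(2)[of k] unfolding P_def by (auto simp: k_def)
        define ws where "ws = us @ butlast vs"
        have ws: "l (Suc k) = l i @ ws @ [K (enum x c, enum x b)]"
          using vs us by (metis append.assoc append_butlast_last_id ws_def)
        define h where "h = length (l i @ ws)"
        have len: "length (l (Suc k)) = Suc h"
          by (simp add: ws h_def)
        have "map f [0..<Suc h] = (l i @ ws) @ [K (enum x c, enum x b)]"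
          using f(1)[of "Suc k"] unfolding len by (simp add: ws)
        then have "map f [0..<h] = l i @ ws" "f h = K (enum x c, enum x b)"
          by (simp_all only: upt_Suc_append le0 map_append list.map append1_eq_conv)
        moreover have "(enum x c, enum x b) \<in> code x"
          using code_enum[OF cx less.prems] cb by simp
        ultimately have "A (l i @ ws) (K (enum x c, enum x b))"
          using x(2)[of h] x(1) by (simp add: K_def)
        moreover have "enum x c \<noteq> enum x b"
          using enum_eq[OF cx less.prems] cb irrefl_r by auto
        ultimately have "((l (Suc k), enum x c), (l i, enum x b)) \<in> R"
          unfolding R_def using ws l(1)[of "Suc k"] by auto
        then have "(\<rho> (l (Suc k), enum x c), \<rho> (l i, enum x b)) \<in> r"
          by (rule \<rho>(2))
        moreover have "(c, \<rho> (l (Suc k), enum x c)) \<in> r\<^sup>="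
          using less.IH[OF cb cx] .
        ultimately show ?thesis
          using trans_r by (auto dest: transD)
      qed
      have "b \<in> W" "\<rho> (l i, enum x b) \<in> W"
        using less.prems r_sub \<rho>(1) by auto
      then show ?case
        using total_r below irrefl_r unfolding total_on_def by blast
    qed
    \<comment> \<open>All points below \<open>x\<close> are below \<open>w\<close>, so
      \<open>x\<close> is at most \<open>w\<close> and belongs to \<open>D\<close>, which the run
      was built to avoid.\<close>
    have "(b, w) \<in> r" if "(b, x) \<in> r" for b
      using rank[OF that, of 0] w(2)[of "(l 0, enum x b)"] l(1) trans_r by (auto dest: transD)
    then have "(w, x) \<notin> r"
      using irrefl_r by blast
    then show ?thesis
      using total_r x(1) w(1) unfolding total_on_def D_def by blast
  qed
  then obtain i where "a i = x"
    using from_nat_into_surj[OF D(1)] unfolding a_def by blast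
  then show False
    using neq by blast
qed

end


section \<open>Complete Boolean algebras\<close>

locale complete_boolean = complete_lattice L for L (structure) +
  assumes BA: "complete_BA L"
begin

lemma meet_join_distrib:
  "x \<in> carrier L \<Longrightarrow> y \<in> carrier L \<Longrightarrow> z \<in> carrier L \<Longrightarrow>
    x \<sqinter> (y \<squnion> z) = (x \<sqinter> y) \<squnion> (x \<sqinter> z)"
  using BA unfolding complete_BA_def by blast

lemma meet_commute: "x \<sqinter> y = y \<sqinter> x"
  by (simp add: meet_def insert_commute)

lemma join_commute: "x \<squnion> y = y \<squnion> x"
  by (simp add: join_def insert_commute)

lemma le_bottom_iff: "x \<in> carrier L \<Longrightarrow> x \<sqsubseteq> \<bottom> \<longleftrightarrow> x = \<bottom>"
  using bottom_lower le_antisym by auto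

lemma meet_bottom: "x \<in> carrier L \<Longrightarrow> x \<sqinter> \<bottom> = \<bottom>"
  using le_bottom_iff[of "x \<sqinter> \<bottom>"] meet_right[of x \<bottom>] by simp

lemma meet_top: "x \<in> carrier L \<Longrightarrow> \<top> \<sqinter> x = x"
  by (intro le_antisym meet_right meet_le) auto

lemma join_bottom: "x \<in> carrier L \<Longrightarrow> \<bottom> \<squnion> x = x"
  by (intro le_antisym join_right join_le) auto

text \<open>Distributivity makes complements unique, so the definite description in
  \<open>compl\<close> denotes one.\<close>

lemma compl_props:
  assumes "x \<in> carrier L"
  shows "compl L x \<in> carrier L \<and> x \<sqinter> compl L x = \<bottom> \<and> x \<squnion> compl L x = \<top>"
proof -
  obtain y where y: "y \<in> carrier L" "x \<sqinter> y = \<bottom>" "x \<squnion> y = \<top>"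
    using BA assms unfolding complete_BA_def by blast
  have le: "u \<sqsubseteq> v" if "u \<in> carrier L" "x \<sqinter> u = \<bottom>" "v \<in> carrier L" "x \<squnion> v = \<top>" for u v
  proof -
    have "u = u \<sqinter> (x \<squnion> v)"
      using that by (simp add: meet_commute[of u] meet_top)
    also have "\<dots> = (u \<sqinter> x) \<squnion> (u \<sqinter> v)"
      using that(1,3) assms by (intro meet_join_distrib)
    also have "\<dots> = u \<sqinter> v"
      using that by (simp add: meet_commute[of u x] join_bottom)
    finally show ?thesis
      using that meet_right by metis
  qed
  have "z = y" if "z \<in> carrier L \<and> x \<sqinter> z = \<bottom> \<and> x \<squnion> z = \<top>" for z
    using le[of z y] le[of y z] that y by (intro le_antisym) auto
  then have "\<exists>!z. z \<in> carrier L \<and> x \<sqinter> z = \<bottom> \<and> x \<squnion> z = \<top>"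
    using y by blast
  then show ?thesis
    unfolding compl_def by (rule theI')
qed

lemma compl_closed [simp]: "x \<in> carrier L \<Longrightarrow> compl L x \<in> carrier L"
  using compl_props by blast

lemma implies_closed [simp]:
  "x \<in> carrier L \<Longrightarrow> y \<in> carrier L \<Longrightarrow> implies L x y \<in> carrier L"
  by (simp add: implies_def)

text \<open>Residuation, the source of the law for complements and of the infinite distributive law
  below.\<close>

lemma le_implies_iff:
  assumes [simp]: "x \<in> carrier L" "a \<in> carrier L" "u \<in> carrier L"
  shows "a \<sqsubseteq> implies L x u \<longleftrightarrow> x \<sqinter> a \<sqsubseteq> u"
proof
  assume "a \<sqsubseteq> implies L x u"
  then have "x \<sqinter> a \<sqsubseteq> x \<sqinter> (compl L x \<squnion> u)"
    unfolding implies_def by (intro meet_le meet_left le_trans[OF meet_right]) auto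
  also have "\<dots> = x \<sqinter> u"
    using compl_props[of x] by (simp add: meet_join_distrib join_bottom)
  also have "x \<sqinter> u \<sqsubseteq> u"
    by (simp add: meet_right)
  finally show "x \<sqinter> a \<sqsubseteq> u"
    by simp
next
  assume "x \<sqinter> a \<sqsubseteq> u"
  have "a = a \<sqinter> (x \<squnion> compl L x)"
    using compl_props[of x] meet_commute[of a] by (simp add: meet_top)
  also have "\<dots> = (a \<sqinter> x) \<squnion> (a \<sqinter> compl L x)"
    by (simp add: meet_join_distrib)
  also have "\<dots> \<sqsubseteq> compl L x \<squnion> u"
  proof (rule join_le)
    show "a \<sqinter> x \<sqsubseteq> compl L x \<squnion> u"
      using \<open>x \<sqinter> a \<sqsubseteq> u\<close> meet_commute[of a x] join_right[of "compl L x" u] by (auto intro: le_trans)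
    show "a \<sqinter> compl L x \<sqsubseteq> compl L x \<squnion> u"
      using meet_right[of a "compl L x"] join_left[of "compl L x" u] by (auto intro: le_trans)
  qed auto
  finally show "a \<sqsubseteq> implies L x u"
    by (simp add: implies_def)
qed

lemma le_compl_iff:
  assumes "x \<in> carrier L" "a \<in> carrier L"
  shows "a \<sqsubseteq> compl L x \<longleftrightarrow> x \<sqinter> a = \<bottom>"
  using le_implies_iff[of x a \<bottom>] assms
  by (simp add: implies_def join_commute[of _ \<bottom>] join_bottom le_bottom_iff)

text \<open>Infinite distributivity in the form of upper bounds: by residuation each
  \<open>a\<close> is below \<open>implies L x u\<close>, hence so is the supremum.\<close>

lemma meet_sup_le:
  assumes "A \<subseteq> carrier L" "x \<in> carrier L" "u \<in> carrier L" "\<And>a. a \<in> A \<Longrightarrow> x \<sqinter> a \<sqsubseteq> u"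
  shows "x \<sqinter> \<Squnion>A \<sqsubseteq> u"
proof -
  have "\<Squnion>A \<sqsubseteq> implies L x u"
    using assms by (intro sup_least) (auto simp: le_implies_iff Upper_def)
  then show ?thesis
    using assms by (simp add: le_implies_iff)
qed

lemma meet_sup_eq_bottom:
  assumes "A \<subseteq> carrier L" "x \<in> carrier L" "\<And>a. a \<in> A \<Longrightarrow> x \<sqinter> a = \<bottom>"
  shows "x \<sqinter> \<Squnion>A = \<bottom>"
  using meet_sup_le[of A x \<bottom>] assms by (simp add: le_bottom_iff)

lemma meet_eq_bottom_mono:
  assumes "x \<sqsubseteq> y" "y \<sqinter> z = \<bottom>" "x \<in> carrier L" "y \<in> carrier L" "z \<in> carrier L"
  shows "x \<sqinter> z = \<bottom>"
proof -
  have "x \<sqinter> z \<sqsubseteq> y \<sqinter> z"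
    using assms by (intro meet_le meet_right le_trans[OF meet_left]) auto
  then show ?thesis
    using assms by (simp add: le_bottom_iff)
qed


section \<open>Runs of the cut and choose game\<close>

text \<open>The answers are a function of the cuts alone, because under a fixed strategy the cuts
  determine the earlier answers.\<close>

definition consistent :: "('a list \<Rightarrow> 'a \<Rightarrow> bool) \<Rightarrow> 'a list \<Rightarrow> 'a \<Rightarrow> bool" where
  "consistent A bs q \<longleftrightarrow>
     (\<forall>i < length bs. if A (take i bs) (bs ! i) then q \<sqsubseteq> bs ! i else q \<sqinter> bs ! i = \<bottom>)"

lemma consistent_map:
  "consistent A (map f [0..<n]) q \<longleftrightarrow>
     (\<forall>i < n. if A (map f [0..<i]) (f i) then q \<sqsubseteq> f i else q \<sqinter> f i = \<bottom>)"
  by (simp add: consistent_def take_map_upt)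

definition winning :: "'a \<Rightarrow> ('a list \<Rightarrow> 'a \<Rightarrow> bool) \<Rightarrow> bool" where
  "winning p A \<longleftrightarrow> (\<forall>f. range f \<subseteq> carrier L \<longrightarrow>
     (\<exists>q \<in> carrier L. q \<noteq> \<bottom> \<and> q \<sqsubseteq> p \<and> (\<forall>n. consistent A (map f [0..<n]) q)))"

text \<open>\<open>hist\<close> rebuilds the completed rounds from the cuts, and the element in the
  winning condition of the game serves as \<open>q\<close>.\<close>

lemma winning_answers:
  assumes \<sigma>: "winning_strategy_II L \<sigma>" and p: "p \<in> carrier L" "p \<noteq> \<bottom>"
  shows "\<exists>A. winning p A"
proof -
  define hist where "hist = foldl (\<lambda>h b. h @ [(b, \<sigma> p h b)]) []"
  define A where "A bs b = \<sigma> p (hist bs) b" for bs b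
  have "winning p A"
    unfolding winning_def
  proof (intro allI impI)
    fix f :: "nat \<Rightarrow> 'a" assume f: "range f \<subseteq> carrier L"
    define r where "r n = A (map f [0..<n]) (f n)" for n
    have "hist (map f [0..<n]) = map (\<lambda>i. (f i, r i)) [0..<n]" for n
    proof (induction n)
      case (Suc n)
      have "hist (map f [0..<Suc n]) = hist (map f [0..<n]) @ [(f n, r n)]"
        by (simp add: r_def A_def hist_def)
      then show ?case
        using Suc by simp
    qed (simp add: hist_def)
    then have "r n = \<sigma> p (map (\<lambda>i. (f i, r i)) [0..<n]) (f n)" for n
      by (simp add: r_def[of n] A_def)
    moreover have "f n \<in> carrier L" for n
      using f by auto
    ultimately have "II_wins_run L p f r"
      using p by (intro \<sigma>[unfolded winning_strategy_II_def, rule_format]) blast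
    then have ne: "p \<sqinter> (\<Sqinter>{f i | i. r i}) \<sqinter> compl L (\<Squnion>{f i | i. \<not> r i}) \<noteq> \<bottom>" (is "?q \<noteq> _")
      unfolding II_wins_run_def .
    have sub: "{f i | i. r i} \<subseteq> carrier L" "{f i | i. \<not> r i} \<subseteq> carrier L"
      using f by auto
    have c: "\<Sqinter>{f i | i. r i} \<in> carrier L" "\<Squnion>{f i | i. \<not> r i} \<in> carrier L"
      using sub by auto
    then have q: "?q \<in> carrier L"
      using p by auto
    have le: "?q \<sqsubseteq> p \<sqinter> (\<Sqinter>{f i | i. r i})" "?q \<sqsubseteq> compl L (\<Squnion>{f i | i. \<not> r i})"
      using c p by (auto intro: meet_left meet_right)
    have le': "?q \<sqsubseteq> p" "?q \<sqsubseteq> \<Sqinter>{f i | i. r i}"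
      using c p q le(1) meet_left[of p "\<Sqinter>{f i | i. r i}"] meet_right[of p "\<Sqinter>{f i | i. r i}"]
      by (auto intro: le_trans)
    have "?q \<sqsubseteq> f i" if "r i" for i
    proof (rule le_trans[OF le'(2) inf_lower[OF sub(1)]])
      show "f i \<in> {f i | i. r i}"
        using that by blast
    qed (use c q f in auto)
    moreover have "?q \<sqinter> f i = \<bottom>" if "\<not> r i" for i
    proof -
      have "\<Squnion>{f i | i. \<not> r i} \<sqinter> ?q = \<bottom>"
        using le(2) q c le_compl_iff by blast
      moreover have "f i \<sqsubseteq> \<Squnion>{f i | i. \<not> r i}"
        using sup_upper[OF sub(2)] that by blast
      ultimately have "f i \<sqinter> ?q = \<bottom>"
        using q c f by (intro meet_eq_bottom_mono[of "f i" "\<Squnion>{f i | i. \<not> r i}"]) auto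
      then show ?thesis
        using meet_commute[of "f i"] by metis
    qed
    ultimately have "\<forall>n. consistent A (map f [0..<n]) ?q"
      unfolding consistent_map by (simp add: r_def)
    with q ne le' show "\<exists>q \<in> carrier L. q \<noteq> \<bottom> \<and> q \<sqsubseteq> p \<and> (\<forall>n. consistent A (map f [0..<n]) q)"
      by blast
  qed
  then show ?thesis
    by blast
qed

text \<open>The cut \<open>\<Squnion>(a ` W)\<close> is made first, so that \<open>a\<close> need not be a partition of unity.\<close>

lemma decide_countably:
  assumes A: "winning p A" and bs: "set bs \<subseteq> carrier L"
    and W: "countable_segments W r"
    and a: "a \<in> W \<rightarrow> carrier L"
      "\<And>\<alpha> \<beta>. \<alpha> \<in> W \<Longrightarrow> \<beta> \<in> W \<Longrightarrow> \<alpha> \<noteq> \<beta> \<Longrightarrow> a \<alpha> \<sqinter> a \<beta> = \<bottom>"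
  shows "\<exists>cs U. cs \<noteq> [] \<and> set cs \<subseteq> carrier L \<and> U \<subseteq> W \<and> countable U \<and>
    (\<forall>q \<in> carrier L. consistent A (bs @ cs) q \<longrightarrow> (\<forall>\<alpha> \<in> W - U. q \<sqinter> a \<alpha> = \<bottom>))"
proof -
  \<comment> \<open>With \<open>a \<alpha>\<close> as the value of \<open>x = \<alpha>\<close>,
    \<open>b U\<close> is the value of \<open>x \<in> U\<close>.\<close>
  define b where "b U = \<Squnion>(a ` U)" for U
  have aU: "a ` U \<subseteq> carrier L" if "U \<subseteq> W" for U
    using a(1) that by auto
  have b: "b U \<in> carrier L" if "U \<subseteq> W" for U
    using aU[OF that] by (simp add: b_def)
  have below: "a \<alpha> \<sqsubseteq> b U" if "U \<subseteq> W" "\<alpha> \<in> U" for \<alpha> U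
    unfolding b_def using aU that by (intro sup_upper) auto
  have off: "b U \<sqinter> a \<alpha> = \<bottom>" if "U \<subseteq> W" "\<alpha> \<in> W - U" for \<alpha> U
  proof -
    have "a \<alpha> \<sqinter> b U = \<bottom>"
      unfolding b_def using aU that a(1) by (intro meet_sup_eq_bottom) (auto intro!: a(2))
    then show ?thesis
      by (simp add: meet_commute)
  qed
  have last: "if A us c then q \<sqsubseteq> c else q \<sqinter> c = \<bottom>" if "consistent A (us @ [c]) q" for us c q
    using that[unfolded consistent_def, rule_format, of "length us"] by (simp split: if_splits)
  show ?thesis
  proof (cases "A bs (b W)")
    \<comment> \<open>If \<open>x\<close> is denied to be in \<open>W\<close> at all, the empty set
      of candidates will do.\<close>
    case False
    have "q \<sqinter> a \<alpha> = \<bottom>" if q: "q \<in> carrier L" "consistent A (bs @ [b W]) q" "\<alpha> \<in> W" for q \<alpha>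
    proof -
      have "b W \<sqinter> q = \<bottom>"
        using last[OF q(2)] False by (simp add: meet_commute)
      then have "a \<alpha> \<sqinter> q = \<bottom>"
        using below[OF _ q(3)] q a(1) b by (intro meet_eq_bottom_mono[of "a \<alpha>" "b W"]) auto
      then show ?thesis
        by (simp add: meet_commute)
    qed
    then show ?thesis
      using b by (intro exI[of _ "[b W]"] exI[of _ "{}"]) auto
  next
    case True
    interpret W: countable_segments W r
      by (rule W)
    \<comment> \<open>The game after \<open>bs\<close> and the accepted cut \<open>b W\<close>, read
      as a game on subsets of \<open>W\<close>.\<close>
    define A' where "A' us U = A (bs @ b W # map b us) (b U)" for us U
    have "\<exists>us U. set us \<subseteq> Pow W \<and> U \<subseteq> W \<and> countable U \<and> A' us U"
    proof (rule W.countable_cut_accepted)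
      fix f assume f: "\<And>n::nat. f n \<subseteq> W"
      define g where "g i = (if i < Suc (length bs) then (bs @ [b W]) ! i else b (f (i - Suc (length bs))))" for i
      have g_map: "map g [0..<Suc (length bs) + n] = bs @ b W # map b (map f [0..<n])" for n
      proof (induction n)
        case 0
        have "map g [0..<Suc (length bs)] = bs @ [b W]"
          by (rule nth_equalityI) (simp_all add: g_def del: upt_Suc)
        then show ?case
          by simp
      next
        case (Suc n)
        then show ?case
          by (simp add: g_def)
      qed
      have "g i \<in> carrier L" for i
      proof (cases "i < Suc (length bs)")
        case True
        then have "g i \<in> set (bs @ [b W])"
          unfolding g_def by (metis length_append_singleton nth_mem)
        then show ?thesis
          using bs b by auto
      qed (use b f in \<open>simp add: g_def\<close>)
      then obtain q where q: "q \<in> carrier L" "q \<noteq> \<bottom>" "\<And>n. consistent A (map g [0..<n]) q"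
        using A unfolding winning_def by blast
      have "g (length bs) = b W" "map g [0..<length bs] = bs"
        using g_map[of 0] by (simp_all add: g_def)
      then have "q \<sqsubseteq> b W"
        using q(3)[of "Suc (length bs)"] True unfolding consistent_map by (auto dest: spec[of _ "length bs"])
      \<comment> \<open>As \<open>q\<close> is below \<open>b W\<close>, it meets some
        \<open>a \<alpha>\<close>. This \<open>\<alpha>\<close> is the hidden point: an accepted cut
        is above \<open>q\<close> and so meets \<open>a \<alpha>\<close>, while a refused one is
        disjoint from \<open>q\<close> and so not above \<open>a \<alpha>\<close>.\<close>
      have "\<exists>\<alpha> \<in> W. q \<sqinter> a \<alpha> \<noteq> \<bottom>"
      proof (rule ccontr)
        assume "\<not> ?thesis"
        then have "q \<sqinter> b W = \<bottom>"
          unfolding b_def using aU q(1) by (intro meet_sup_eq_bottom) auto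
        moreover have "q \<sqsubseteq> q \<sqinter> b W"
          using q(1) \<open>q \<sqsubseteq> b W\<close> b by (intro meet_le) auto
        ultimately show False
          using q le_bottom_iff by simp
      qed
      then obtain \<alpha> where \<alpha>: "\<alpha> \<in> W" "q \<sqinter> a \<alpha> \<noteq> \<bottom>"
        by blast
      have "A' (map f [0..<n]) (f n) \<longleftrightarrow> \<alpha> \<in> f n" for n
      proof -
        have gn: "g (Suc (length bs) + n) = b (f n)"
          by (simp add: g_def)
        have A'A: "A' (map f [0..<n]) (f n) = A (map g [0..<Suc (length bs) + n]) (g (Suc (length bs) + n))"
          unfolding A'_def g_map gn ..
        have ans: "if A' (map f [0..<n]) (f n) then q \<sqsubseteq> b (f n) else q \<sqinter> b (f n) = \<bottom>"
          using q(3)[of "Suc (Suc (length bs) + n)"] unfolding A'A consistent_map gn[symmetric] by blast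
        show ?thesis
        proof
          assume "A' (map f [0..<n]) (f n)"
          then have "q \<sqsubseteq> b (f n)"
            using ans by simp
          then show "\<alpha> \<in> f n"
            using meet_eq_bottom_mono[OF _ off[OF f], of q n \<alpha>] \<alpha> q(1) b[OF f] a(1) by blast
        next
          assume "\<alpha> \<in> f n"
          show "A' (map f [0..<n]) (f n)"
          proof (rule ccontr)
            assume "\<not> ?thesis"
            then have "b (f n) \<sqinter> q = \<bottom>"
              using ans by (simp add: meet_commute)
            then have "a \<alpha> \<sqinter> q = \<bottom>"
              using below[OF f \<open>\<alpha> \<in> f n\<close>] q(1) b[OF f] a(1) \<alpha>(1)
              by (intro meet_eq_bottom_mono[of "a \<alpha>" "b (f n)"]) auto
            then show False
              using \<alpha>(2) by (simp add: meet_commute)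
          qed
        qed
      qed
      with \<alpha>(1) show "\<exists>\<alpha> \<in> W. \<forall>n. A' (map f [0..<n]) (f n) \<longleftrightarrow> \<alpha> \<in> f n"
        by blast
    qed
    then obtain us U where U: "set us \<subseteq> Pow W" "U \<subseteq> W" "countable U" "A' us U"
      by blast
    \<comment> \<open>The last cut is the accepted countable one, so every \<open>q\<close>
      consistent with this continuation is below \<open>b U\<close>.\<close>
    define cs where "cs = b W # map b us @ [b U]"
    have "q \<sqinter> a \<alpha> = \<bottom>" if q: "q \<in> carrier L" "consistent A (bs @ cs) q" "\<alpha> \<in> W - U" for q \<alpha>
    proof -
      have "q \<sqsubseteq> b U"
        using last[of "bs @ b W # map b us" "b U" q] q(2) U(4) by (simp add: cs_def A'_def)
      then show ?thesis
        using off[OF U(2) q(3)] q b[OF U(2)] a(1) by (intro meet_eq_bottom_mono[of q "b U"]) auto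
    qed
    moreover have "set cs \<subseteq> carrier L"
      using U b by (auto simp: cs_def)
    ultimately show ?thesis
      using U by (intro exI[of _ cs] exI[of _ U]) (auto simp: cs_def)
  qed
qed

end


section \<open>Boolean values of equality and membership\<close>

lemma pairs_induct:
  assumes "\<And>x. (\<And>y b. (y, b) \<in> pairs x \<Longrightarrow> P y) \<Longrightarrow> P x"
  shows "P x"
  using wf_trancl[OF wf_mem_rel]
proof (induction x rule: wf_induct_rule)
  case (less x)
  then show ?case
    using assms pairs_mem_rel by blast
qed

lemma name_pairs:
  assumes "name L x" "(y, b) \<in> pairs x"
  shows "name L y" "b \<in> carrier L"
proof -
  have "\<exists>y' b'. hpair y b = hpair y' b' \<and> name L y' \<and> b' \<in> carrier L"
    using assms(1)
  proof cases
    case nameI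
    then show ?thesis
      using assms(2) by (simp add: pairs_def)
  qed
  then show "name L y" "b \<in> carrier L"
    by (auto simp: hpair_inject)
qed

lemma elts_check_name: "elts (check_name L x) = (\<lambda>y. hpair (check_name L y) \<top>\<^bsub>L\<^esub>) ` elts x"
proof -
  have "|elts x| \<le>o |UNIV :: ('a + nat) set|"
    using small_iff_set by blast
  then have "|(\<lambda>y. hpair (check_name L y) \<top>\<^bsub>L\<^esub>) ` elts x| \<le>o |UNIV :: ('a + nat) set|"
    using card_of_image ordLeq_transitive by blast
  then show ?thesis
    unfolding check_name.simps[of L x] by (rule elts_hset_of)
qed

lemma pairs_check_name: "pairs (check_name L x) = (\<lambda>y. (check_name L y, \<top>\<^bsub>L\<^esub>)) ` elts x"
  by (auto simp: pairs_def elts_check_name hpair_inject)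

locale hset_boolean = complete_boolean L for L :: "'u hset gorder" (structure)
begin

text \<open>Boolean values are computed by their lower bounds, in the style of the forcing relation.\<close>

lemma le_sup_elim:
  assumes "a \<sqsubseteq> \<Squnion>A" "A \<subseteq> carrier L" "a \<in> carrier L" "u \<in> carrier L"
    and step: "\<And>x c. x \<in> A \<Longrightarrow> c \<in> carrier L \<Longrightarrow> c \<sqsubseteq> a \<Longrightarrow> c \<sqsubseteq> x \<Longrightarrow> c \<sqsubseteq> u"
  shows "a \<sqsubseteq> u"
proof -
  have "a \<sqinter> \<Squnion>A \<sqsubseteq> u"
  proof (rule meet_sup_le)
    fix x assume "x \<in> A"
    then have "x \<in> carrier L"
      using assms(2) by blast
    then show "a \<sqinter> x \<sqsubseteq> u"
      using \<open>x \<in> A\<close> assms(3) by (intro step[of x]) (auto intro: meet_left meet_right)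
  qed (use assms in auto)
  moreover have "a \<sqsubseteq> a \<sqinter> \<Squnion>A"
    using assms by (intro meet_le) auto
  ultimately show ?thesis
    using assms by (meson le_trans meet_closed sup_closed)
qed

lemma le_implies:
  assumes "x \<in> carrier L" "a \<in> carrier L" "u \<in> carrier L"
  shows "a \<sqsubseteq> implies L x u \<longleftrightarrow> (\<forall>c \<in> carrier L. c \<sqsubseteq> a \<and> c \<sqsubseteq> x \<longrightarrow> c \<sqsubseteq> u)"
  unfolding le_implies_iff[OF assms]
proof
  assume *: "x \<sqinter> a \<sqsubseteq> u"
  show "\<forall>c \<in> carrier L. c \<sqsubseteq> a \<and> c \<sqsubseteq> x \<longrightarrow> c \<sqsubseteq> u"
  proof (intro ballI impI)
    fix c assume "c \<in> carrier L" "c \<sqsubseteq> a \<and> c \<sqsubseteq> x"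
    then have "c \<sqsubseteq> x \<sqinter> a"
      using assms by (intro meet_le) auto
    then show "c \<sqsubseteq> u"
      using * assms \<open>c \<in> carrier L\<close> by (meson le_trans meet_closed)
  qed
next
  assume "\<forall>c \<in> carrier L. c \<sqsubseteq> a \<and> c \<sqsubseteq> x \<longrightarrow> c \<sqsubseteq> u"
  then show "x \<sqinter> a \<sqsubseteq> u"
    using assms by (auto intro: meet_left meet_right)
qed

lemma bval_eq_closed: "name L x \<Longrightarrow> name L y \<Longrightarrow> bval_eq L x y \<in> carrier L"
proof (induction x arbitrary: y rule: pairs_induct)
  case (1 x)
  have c: "c \<sqinter> bval_eq L z w \<in> carrier L" "b \<sqinter> bval_eq L z w \<in> carrier L" "b \<in> carrier L" "c \<in> carrier L"
    if "(z, b) \<in> pairs x" "(w, c) \<in> pairs y" for z b w c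
    using 1 name_pairs that by (metis meet_closed)+
  have "\<Squnion>((\<lambda>(w, c). c \<sqinter> bval_eq L z w) ` pairs y) \<in> carrier L" if "(z, b) \<in> pairs x" for z b
    using c that by (intro sup_closed) auto
  moreover have "\<Squnion>((\<lambda>(z, b). b \<sqinter> bval_eq L z w) ` pairs x) \<in> carrier L" if "(w, c) \<in> pairs y" for w c
    using c that by (intro sup_closed) auto
  ultimately show ?case
    unfolding bval_eq.simps[of L x y] using name_pairs[OF 1(2)] name_pairs[OF 1(3)]
    by (intro meet_closed inf_closed) (auto intro!: implies_closed)
qed

text \<open>Exchanging \<open>x\<close> and \<open>y\<close> exchanges the two halves of the
  definition, up to the order of arguments in the recursive values, which the induction hypothesis
  corrects.\<close>

lemma bval_eq_sym: "bval_eq L x y = bval_eq L y x"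
proof (induction x arbitrary: y rule: pairs_induct)
  case (1 x)
  have eq1: "(\<lambda>(z, b). implies L b (\<Squnion>((\<lambda>(w, c). c \<sqinter> bval_eq L z w) ` pairs y))) ` pairs x =
      (\<lambda>(z, b). implies L b (\<Squnion>((\<lambda>(w, c). c \<sqinter> bval_eq L w z) ` pairs y))) ` pairs x"
  proof (rule image_cong[OF HOL.refl])
    fix v assume v: "v \<in> pairs x"
    obtain z b where zb: "v = (z, b)"
      by (cases v)
    have "bval_eq L z = (\<lambda>w. bval_eq L w z)"
      using 1 v zb by (intro ext) blast
    then show "(case v of (z, b) \<Rightarrow> implies L b (\<Squnion>((\<lambda>(w, c). c \<sqinter> bval_eq L z w) ` pairs y))) =
        (case v of (z, b) \<Rightarrow> implies L b (\<Squnion>((\<lambda>(w, c). c \<sqinter> bval_eq L w z) ` pairs y)))"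
      unfolding zb prod.case by (rule arg_cong)
  qed
  have eq2: "(\<lambda>(z, b). b \<sqinter> bval_eq L z w) ` pairs x = (\<lambda>(z, b). b \<sqinter> bval_eq L w z) ` pairs x" for w
  proof (rule image_cong[OF HOL.refl])
    fix v assume v: "v \<in> pairs x"
    obtain z b where zb: "v = (z, b)"
      by (cases v)
    have "bval_eq L z w = bval_eq L w z"
      using 1 v zb by blast
    then show "(case v of (z, b) \<Rightarrow> b \<sqinter> bval_eq L z w) = (case v of (z, b) \<Rightarrow> b \<sqinter> bval_eq L w z)"
      unfolding zb prod.case by (rule arg_cong)
  qed
  show ?case
    unfolding bval_eq.simps[of L x y] bval_eq.simps[of L y x] eq1 eq2 by (rule meet_commute)
qed

lemma bval_mem_terms_closed:
  assumes "name L x" "name L y"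
  shows "(\<lambda>(w, c). c \<sqinter> bval_eq L x w) ` pairs y \<subseteq> carrier L"
proof clarify
  fix w c assume "(w, c) \<in> pairs y"
  then show "c \<sqinter> bval_eq L x w \<in> carrier L"
    using assms name_pairs[of L y w c] by (intro meet_closed bval_eq_closed) auto
qed

lemma bval_mem_closed:
  assumes "name L x" "name L y"
  shows "bval_mem L x y \<in> carrier L"
  unfolding bval_mem_def by (intro sup_closed bval_mem_terms_closed assms)

lemma bval_memI:
  assumes "(w, c) \<in> pairs y" "a \<sqsubseteq> c" "a \<sqsubseteq> bval_eq L x w" "a \<in> carrier L" "name L x" "name L y"
  shows "a \<sqsubseteq> bval_mem L x y"
proof -
  have sub: "(\<lambda>(w, c). c \<sqinter> bval_eq L x w) ` pairs y \<subseteq> carrier L"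
    using assms(5,6) by (rule bval_mem_terms_closed)
  have c: "c \<in> carrier L" "bval_eq L x w \<in> carrier L"
    using assms(5) name_pairs[OF assms(6,1)] by (auto intro: bval_eq_closed)
  then have "a \<sqsubseteq> c \<sqinter> bval_eq L x w"
    using assms by (intro meet_le)
  moreover have "c \<sqinter> bval_eq L x w \<sqsubseteq> bval_mem L x y"
    unfolding bval_mem_def using assms(1) by (intro sup_upper[OF sub]) auto
  ultimately show ?thesis
    using assms c bval_mem_closed[OF assms(5,6)] by (meson le_trans meet_closed)
qed

text \<open>A condition forcing membership need not settle which element of \<open>y\<close> is met,
  so the conclusion is to be shown for the smaller conditions that do.\<close>

lemma bval_memE:
  assumes "a \<sqsubseteq> bval_mem L x y" "name L x" "name L y" "a \<in> carrier L" "u \<in> carrier L"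
    and step: "\<And>a' w c. (w, c) \<in> pairs y \<Longrightarrow> a' \<in> carrier L \<Longrightarrow> a' \<sqsubseteq> a \<Longrightarrow> a' \<sqsubseteq> c \<Longrightarrow>
      a' \<sqsubseteq> bval_eq L x w \<Longrightarrow> a' \<sqsubseteq> u"
  shows "a \<sqsubseteq> u"
proof (rule le_sup_elim[OF assms(1)[unfolded bval_mem_def]])
  show "(\<lambda>(w, c). c \<sqinter> bval_eq L x w) ` pairs y \<subseteq> carrier L"
    using assms(2,3) by (rule bval_mem_terms_closed)
  fix v a' assume "v \<in> (\<lambda>(w, c). c \<sqinter> bval_eq L x w) ` pairs y" and a': "a' \<in> carrier L" "a' \<sqsubseteq> a" "a' \<sqsubseteq> v"
  then obtain w c where wc: "(w, c) \<in> pairs y" "v = c \<sqinter> bval_eq L x w"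
    by auto
  have c: "c \<in> carrier L" "bval_eq L x w \<in> carrier L"
    using assms(2) name_pairs[OF assms(3) wc(1)] by (auto intro: bval_eq_closed)
  have "a' \<sqsubseteq> c" "a' \<sqsubseteq> bval_eq L x w"
    using le_trans[OF a'(3)[unfolded wc(2)] meet_left[OF c]]
      le_trans[OF a'(3)[unfolded wc(2)] meet_right[OF c]] a' c by auto
  then show "a' \<sqsubseteq> u"
    using step wc a' by blast
qed (use assms in auto)

text \<open>The forcing clause of extensionality, which replaces the recursive definition from here
  on.\<close>

lemma le_bval_eq_iff:
  assumes x: "name L x" and y: "name L y" and a: "a \<in> carrier L"
  shows "a \<sqsubseteq> bval_eq L x y \<longleftrightarrow>
    (\<forall>(z, b) \<in> pairs x. \<forall>c \<in> carrier L. c \<sqsubseteq> a \<and> c \<sqsubseteq> b \<longrightarrow> c \<sqsubseteq> bval_mem L z y) \<and>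
    (\<forall>(z, b) \<in> pairs y. \<forall>c \<in> carrier L. c \<sqsubseteq> a \<and> c \<sqsubseteq> b \<longrightarrow> c \<sqsubseteq> bval_mem L z x)"
proof -
  define I where "I x y = (\<lambda>(z, b). implies L b (bval_mem L z y)) ` pairs x" for x y
  have sub: "I x y \<subseteq> carrier L" if "name L x" "name L y" for x y
    unfolding I_def
  proof clarify
    fix z b assume "(z, b) \<in> pairs x"
    then show "implies L b (bval_mem L z y) \<in> carrier L"
      using that name_pairs[of L x z b] by (intro implies_closed bval_mem_closed) auto
  qed
  have le_I: "a \<sqsubseteq> \<Sqinter>(I x y) \<longleftrightarrow>
      (\<forall>(z, b) \<in> pairs x. \<forall>c \<in> carrier L. c \<sqsubseteq> a \<and> c \<sqsubseteq> b \<longrightarrow> c \<sqsubseteq> bval_mem L z y)"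
    if xy: "name L x" "name L y" for x y
  proof -
    have "a \<sqsubseteq> \<Sqinter>(I x y) \<longleftrightarrow> (\<forall>i \<in> I x y. a \<sqsubseteq> i)"
    proof
      assume *: "a \<sqsubseteq> \<Sqinter>(I x y)"
      show "\<forall>i \<in> I x y. a \<sqsubseteq> i"
      proof
        fix i assume "i \<in> I x y"
        then show "a \<sqsubseteq> i"
          using le_trans[OF * inf_lower[OF sub[OF xy]]] a sub[OF xy] by auto
      qed
    qed (use inf_greatest[OF sub[OF xy] a] in blast)
    also have "\<dots> \<longleftrightarrow> (\<forall>(z, b) \<in> pairs x. a \<sqsubseteq> implies L b (bval_mem L z y))"
      by (auto simp: I_def)
    also have "\<dots> \<longleftrightarrow> (\<forall>(z, b) \<in> pairs x. \<forall>c \<in> carrier L. c \<sqsubseteq> a \<and> c \<sqsubseteq> b \<longrightarrow> c \<sqsubseteq> bval_mem L z y)"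
    proof (intro ball_cong HOL.refl, clarify)
      fix z b assume zb: "(z, b) \<in> pairs x"
      show "a \<sqsubseteq> implies L b (bval_mem L z y) \<longleftrightarrow>
          (\<forall>c \<in> carrier L. c \<sqsubseteq> a \<and> c \<sqsubseteq> b \<longrightarrow> c \<sqsubseteq> bval_mem L z y)"
        using name_pairs[OF xy(1) zb] xy(2) a by (intro le_implies bval_mem_closed)
    qed
    finally show ?thesis .
  qed
  \<comment> \<open>The second half of \<open>bval_eq\<close> compares elements of \<open>x\<close>
    with elements of \<open>y\<close> in this order; symmetry turns it into membership in
    \<open>x\<close>.\<close>
  have "(\<lambda>(w, c). implies L c (\<Squnion>((\<lambda>(z, b). b \<sqinter> bval_eq L z w) ` pairs x))) ` pairs y = I y x"
    unfolding I_def bval_mem_def by (simp only: bval_eq_sym)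
  then have "bval_eq L x y = \<Sqinter>(I x y) \<sqinter> \<Sqinter>(I y x)"
    unfolding bval_eq.simps[of L x y] I_def bval_mem_def by simp
  moreover have "a \<sqsubseteq> u \<sqinter> v \<longleftrightarrow> a \<sqsubseteq> u \<and> a \<sqsubseteq> v" if "u \<in> carrier L" "v \<in> carrier L" for u v
    using that a meet_le meet_left meet_right meet_closed le_trans by meson
  ultimately show ?thesis
    using le_I[OF x y] le_I[OF y x] sub[OF x y] sub[OF y x] by simp
qed

lemma bval_eqD:
  assumes "a \<sqsubseteq> bval_eq L x y" "(z, b) \<in> pairs x" "a \<sqsubseteq> b" "name L x" "name L y" "a \<in> carrier L"
  shows "a \<sqsubseteq> bval_mem L z y"
  using assms le_bval_eq_iff[of x y a] le_refl[of a] by blast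

text \<open>Locally, an element of \<open>x\<close> is matched with one of \<open>y\<close> and that
  with one of \<open>z\<close>, and the induction hypothesis composes the equalities. The way back
  from \<open>z\<close> uses symmetry to keep the induction on \<open>x\<close>.\<close>

lemma bval_eq_trans:
  assumes "a \<sqsubseteq> bval_eq L x y" "a \<sqsubseteq> bval_eq L y z" "name L x" "name L y" "name L z" "a \<in> carrier L"
  shows "a \<sqsubseteq> bval_eq L x z"
  using assms
proof (induction x arbitrary: y z a rule: pairs_induct)
  case (1 x)
  note names = \<open>name L x\<close> \<open>name L y\<close> \<open>name L z\<close>
  have eqc: "bval_eq L x y \<in> carrier L" "bval_eq L y z \<in> carrier L"
    using names bval_eq_closed by auto
  have below: "c \<sqsubseteq> bval_eq L x y" "c \<sqsubseteq> bval_eq L y z" if "c \<in> carrier L" "c \<sqsubseteq> a" for c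
    using that 1 eqc by (meson le_trans)+
  have fwd: "c \<sqsubseteq> bval_mem L u z" if u: "(u, b) \<in> pairs x" and c: "c \<in> carrier L" "c \<sqsubseteq> a" "c \<sqsubseteq> b" for u b c
  proof (rule bval_memE[of c u y])
    have nu: "name L u"
      using name_pairs u names by blast
    show "c \<sqsubseteq> bval_mem L u y" "bval_mem L u z \<in> carrier L" "name L u" "name L y" "c \<in> carrier L"
      using bval_eqD[OF below(1)[OF c(1,2)] u c(3)] names c bval_mem_closed nu by auto
    fix c' w d assume w: "(w, d) \<in> pairs y" and c': "c' \<in> carrier L" "c' \<sqsubseteq> c" "c' \<sqsubseteq> d" "c' \<sqsubseteq> bval_eq L u w"
    have nw: "name L w"
      using name_pairs w names by blast
    have c'a: "c' \<sqsubseteq> a"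
      using c c' 1(7) le_trans by blast
    show "c' \<sqsubseteq> bval_mem L u z"
    proof (rule bval_memE[of c' w z])
      show "c' \<sqsubseteq> bval_mem L w z"
        using bval_eqD[OF below(2)[OF c'(1) c'a] w c'(3)] names c' by blast
      fix c'' v e assume v: "(v, e) \<in> pairs z"
        and c'': "c'' \<in> carrier L" "c'' \<sqsubseteq> c'" "c'' \<sqsubseteq> e" "c'' \<sqsubseteq> bval_eq L w v"
      have nv: "name L v"
        using name_pairs v names by blast
      have "c'' \<sqsubseteq> bval_eq L u w"
        using c' c'' bval_eq_closed[OF nu nw] by (meson le_trans)
      then have "c'' \<sqsubseteq> bval_eq L u v"
        using 1(1)[OF u _ c''(4) nu nw nv c''(1)] by blast
      then show "c'' \<sqsubseteq> bval_mem L u z"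
        using bval_memI v c'' nu names by blast
    qed (use names nw nu c' bval_mem_closed in auto)
  qed
  have bwd: "c \<sqsubseteq> bval_mem L v x" if v: "(v, e) \<in> pairs z" and c: "c \<in> carrier L" "c \<sqsubseteq> a" "c \<sqsubseteq> e" for v e c
  proof (rule bval_memE[of c v y])
    have nv: "name L v"
      using name_pairs v names by blast
    have "c \<sqsubseteq> bval_eq L z y"
      using below(2)[OF c(1,2)] bval_eq_sym[of y z] by simp
    from bval_eqD[OF this v c(3)]
    show "c \<sqsubseteq> bval_mem L v y" "bval_mem L v x \<in> carrier L" "name L v" "name L y" "c \<in> carrier L"
      using names c bval_mem_closed nv by auto
    fix c' w d assume w: "(w, d) \<in> pairs y" and c': "c' \<in> carrier L" "c' \<sqsubseteq> c" "c' \<sqsubseteq> d" "c' \<sqsubseteq> bval_eq L v w"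
    have nw: "name L w"
      using name_pairs w names by blast
    have c'a: "c' \<sqsubseteq> a"
      using c c' 1(7) le_trans by blast
    show "c' \<sqsubseteq> bval_mem L v x"
    proof (rule bval_memE[of c' w x])
      have "c' \<sqsubseteq> bval_eq L y x"
        using below(1)[OF c'(1) c'a] bval_eq_sym[of y x] by simp
      from bval_eqD[OF this w c'(3)] show "c' \<sqsubseteq> bval_mem L w x"
        using names c' by blast
      fix c'' u b assume u: "(u, b) \<in> pairs x"
        and c'': "c'' \<in> carrier L" "c'' \<sqsubseteq> c'" "c'' \<sqsubseteq> b" "c'' \<sqsubseteq> bval_eq L w u"
      have nu: "name L u"
        using name_pairs u names by blast
      have "c'' \<sqsubseteq> bval_eq L w v"
        using c' c'' bval_eq_closed[OF nv nw] bval_eq_sym[of v w] by (metis le_trans)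
      moreover have "c'' \<sqsubseteq> bval_eq L u w"
        using c''(4) bval_eq_sym[of u w] by simp
      ultimately have "c'' \<sqsubseteq> bval_eq L u v"
        using 1(1)[OF u _ _ nu nw nv c''(1)] by blast
      then have "c'' \<sqsubseteq> bval_eq L v u"
        using bval_eq_sym[of u v] by simp
      then show "c'' \<sqsubseteq> bval_mem L v x"
        using bval_memI u c'' nv names by blast
    qed (use names nw nv c' bval_mem_closed in auto)
  qed
  show ?case
    unfolding le_bval_eq_iff[OF names(1,3) 1(7)]
    by (intro conjI; clarify; (rule fwd | rule bwd); assumption)
qed

section \<open>Check names\<close>

lemma name_check_name: "name L (check_name L x)"
  using wf_mem_rel
proof (induction x rule: wf_induct_rule)
  case (less x)
  show ?case
  proof (rule nameI)
    fix z assume "z \<in> elts (check_name L x)"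
    then obtain y where "y \<in> elts x" "z = hpair (check_name L y) \<top>"
      by (auto simp: elts_check_name)
    then show "\<exists>y b. z = hpair y b \<and> name L y \<and> b \<in> carrier L"
      using less[of y] by (auto simp: mem_rel_def)
  qed
qed

text \<open>If \<open>z\<close> lies in only one of \<open>x\<close> and \<open>y\<close>, forcing
  the equality would locally force the check name of \<open>z\<close> to equal that of another set,
  which the induction hypothesis excludes.\<close>

lemma bval_eq_check_name:
  assumes "x \<noteq> y"
  shows "bval_eq L (check_name L x) (check_name L y) = \<bottom>"
proof -
  have "a \<sqsubseteq> \<bottom>" if "a \<in> carrier L" "a \<sqsubseteq> bval_eq L (check_name L x) (check_name L y)" for a
    using wf_mem_rel assms that
  proof (induction x arbitrary: y a rule: wf_induct_rule)
    case (less x)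
    have le: "a \<sqsubseteq> bval_mem L (check_name L z) (check_name L y)" if "z \<in> elts x" for z
      using less.prems that name_check_name
      by (intro bval_eqD[of a "check_name L x" _ _ \<top>]) (auto simp: pairs_check_name)
    have ge: "a \<sqsubseteq> bval_mem L (check_name L z) (check_name L x)" if "z \<in> elts y" for z
      using less.prems that name_check_name bval_eq_sym
      by (intro bval_eqD[of a "check_name L y" _ _ \<top>]) (auto simp: pairs_check_name)
    have "elts x \<noteq> elts y"
      using less.prems(1) hset_ext by blast
    then consider z where "z \<in> elts x" "z \<notin> elts y" | z where "z \<in> elts y" "z \<notin> elts x"
      by blast
    then show ?case
    proof cases
      case 1
      show ?thesis
      proof (rule bval_memE[OF le[OF 1(1)] name_check_name name_check_name less.prems(2)])
        fix a' w c
        assume a': "(w, c) \<in> pairs (check_name L y)" "a' \<in> carrier L" "a' \<sqsubseteq> bval_eq L (check_name L z) w"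
        then obtain w' where "w' \<in> elts y" "w = check_name L w'"
          by (auto simp: pairs_check_name)
        then show "a' \<sqsubseteq> \<bottom>"
          using less.IH[of z w' a'] 1 a' by (auto simp: mem_rel_def)
      qed simp
    next
      case 2
      show ?thesis
      proof (rule bval_memE[OF ge[OF 2(1)] name_check_name name_check_name less.prems(2)])
        fix a' w c
        assume a': "(w, c) \<in> pairs (check_name L x)" "a' \<in> carrier L" "a' \<sqsubseteq> bval_eq L (check_name L z) w"
        then obtain w' where "w' \<in> elts x" "w = check_name L w'"
          by (auto simp: pairs_check_name)
        then show "a' \<sqsubseteq> \<bottom>"
          using less.IH[of w' z a'] 2 a' bval_eq_sym[of "check_name L z" w] by (auto simp: mem_rel_def)
      qed simp
    qed
  qed
  moreover have "bval_eq L (check_name L x) (check_name L y) \<in> carrier L"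
    by (intro bval_eq_closed name_check_name)
  ultimately show ?thesis
    using le_bottom_iff by blast
qed

text \<open>Supplies the disjointness that \<open>decide_countably\<close> demands.\<close>

lemma bval_eq_check_name_disjoint:
  assumes "name L x" "\<alpha> \<noteq> \<beta>"
  shows "bval_eq L x (check_name L \<alpha>) \<sqinter> bval_eq L x (check_name L \<beta>) = \<bottom>"
proof -
  let ?a = "bval_eq L x (check_name L \<alpha>)" and ?b = "bval_eq L x (check_name L \<beta>)"
  have c: "?a \<in> carrier L" "?b \<in> carrier L"
    using assms by (auto intro: bval_eq_closed name_check_name)
  have "?a \<sqinter> ?b \<sqsubseteq> bval_eq L (check_name L \<alpha>) x"
    using meet_left[OF c] unfolding bval_eq_sym[of x "check_name L \<alpha>"] .
  then have "?a \<sqinter> ?b \<sqsubseteq> bval_eq L (check_name L \<alpha>) (check_name L \<beta>)"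
    by (rule bval_eq_trans[OF _ meet_right[OF c]]) (use c assms(1) name_check_name in auto)
  then show ?thesis
    using c assms bval_eq_check_name le_bottom_iff by simp
qed

text \<open>\<open>Iff\<close> expresses implication by negation and conjunction; this is the
  forcing clause for it.\<close>

lemma le_compl_meet_compl:
  assumes "P \<in> carrier L" "R \<in> carrier L" "a \<in> carrier L"
    and imp: "\<And>c. c \<in> carrier L \<Longrightarrow> c \<sqsubseteq> a \<Longrightarrow> c \<sqsubseteq> P \<Longrightarrow> c \<sqsubseteq> R"
  shows "a \<sqsubseteq> compl L (P \<sqinter> compl L R)"
proof -
  let ?c = "P \<sqinter> compl L R \<sqinter> a"
  have c: "P \<sqinter> compl L R \<in> carrier L" "?c \<in> carrier L"
    using assms by auto
  have "?c \<sqsubseteq> P \<sqinter> compl L R" and ca: "?c \<sqsubseteq> a"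
    using c assms by (auto intro: meet_left meet_right)
  then have cP: "?c \<sqsubseteq> P" and cR: "?c \<sqsubseteq> compl L R"
    using c assms meet_left[of P "compl L R"] meet_right[of P "compl L R"] by (auto intro: le_trans)
  have "?c \<sqsubseteq> R \<sqinter> ?c"
    by (rule meet_le) (use imp[OF c(2) ca cP] c assms(2) in auto)
  moreover have "R \<sqinter> ?c = \<bottom>"
    using cR c assms le_compl_iff by blast
  ultimately have "?c = \<bottom>"
    using c le_bottom_iff by simp
  then show ?thesis
    using le_compl_iff c assms by simp
qed

section \<open>The name for \<open>N[G]\<close> and its countable ordinals\<close>

lemma elts_extension_name:
  assumes "countable N"
  shows "elts (extension_name L N) = {hpair x \<top> | x. x \<in> N \<and> name L x}"
proof -
  have "{hpair x \<top> | x. x \<in> N \<and> name L x} = (\<lambda>x. hpair x \<top>) ` {x \<in> N. name L x}"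
    by auto
  moreover have "countable ((\<lambda>x. hpair x \<top>) ` {x \<in> N. name L x})"
    using assms by (intro countable_image countable_subset[OF _ assms]) auto
  ultimately show ?thesis
    unfolding extension_name_def by (simp add: elts_hset_of_countable)
qed

lemma pairs_extension_name:
  "countable N \<Longrightarrow> pairs (extension_name L N) = {(x, \<top>) | x. x \<in> N \<and> name L x}"
  by (auto simp: pairs_def elts_extension_name hpair_inject)

lemma name_extension_name: "countable N \<Longrightarrow> name L (extension_name L N)"
  by (rule nameI) (auto simp: elts_extension_name)

text \<open>A common element of \<open>N[G]\<close> and \<open>\<omega>\<^sub>1\<close> is locally
  equal both to some \<open>x \<in> N\<close> and to some \<open>\<alpha>\<close>, and
  \<open>decided\<close> leaves only \<open>\<alpha> \<in> N\<close>. Conversely, each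
  \<open>\<alpha>\<close> in \<open>N\<close> has its check name in \<open>N\<close>.\<close>

lemma forces_same_omega1I:
  assumes q: "q \<in> carrier L" and N: "countable N"
    and decided: "\<And>x \<alpha>. x \<in> N \<Longrightarrow> name L x \<Longrightarrow> \<alpha> \<in> elts omega1 - N \<Longrightarrow>
      q \<sqinter> bval_eq L x (check_name L \<alpha>) = \<bottom>"
    and check: "\<And>\<alpha>. \<alpha> \<in> N \<inter> elts omega1 \<Longrightarrow> check_name L \<alpha> \<in> N"
  shows "forces_same_omega1 L q N"
proof -
  define E \<Omega> D where "E = extension_name L N" and "\<Omega> = check_name L omega1"
    and "D = check_name L (hset_of (N \<inter> elts omega1))"
  have names: "name L E" "name L \<Omega>" "name L D"
    by (auto simp: E_def \<Omega>_def D_def intro: name_extension_name name_check_name N)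
  have pE: "pairs E = {(x, \<top>) | x. x \<in> N \<and> name L x}"
    unfolding E_def by (rule pairs_extension_name[OF N])
  have p\<Omega>: "pairs \<Omega> = (\<lambda>\<alpha>. (check_name L \<alpha>, \<top>)) ` elts omega1"
    unfolding \<Omega>_def by (rule pairs_check_name)
  have "elts (hset_of (N \<inter> elts omega1)) = N \<inter> elts omega1"
    using N by (intro elts_hset_of_countable countable_Int1)
  then have pD: "pairs D = (\<lambda>\<alpha>. (check_name L \<alpha>, \<top>)) ` (N \<inter> elts omega1)"
    unfolding D_def pairs_check_name by simp
  have main: "q \<sqsubseteq> compl L ((bval_mem L z E \<sqinter> bval_mem L z \<Omega>) \<sqinter> compl L (bval_mem L z D)) \<sqinter>
      compl L (bval_mem L z D \<sqinter> compl L (bval_mem L z E \<sqinter> bval_mem L z \<Omega>))"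
    (is "_ \<sqsubseteq> ?l \<sqinter> ?r")
    if z: "name L z" for z
  proof -
    have cl: "bval_mem L z E \<in> carrier L" "bval_mem L z \<Omega> \<in> carrier L" "bval_mem L z D \<in> carrier L"
      using names z bval_mem_closed by auto
    have "q \<sqsubseteq> ?l"
    proof (rule le_compl_meet_compl)
      fix c assume c: "c \<in> carrier L" "c \<sqsubseteq> q" "c \<sqsubseteq> bval_mem L z E \<sqinter> bval_mem L z \<Omega>"
      have cE: "c \<sqsubseteq> bval_mem L z E" and c\<Omega>: "c \<sqsubseteq> bval_mem L z \<Omega>"
        using le_trans[OF c(3) meet_left] le_trans[OF c(3) meet_right] cl c by auto
      show "c \<sqsubseteq> bval_mem L z D"
      proof (rule bval_memE[OF cE z names(1) c(1) cl(3)])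
        fix c' x b assume "(x, b) \<in> pairs E" and c': "c' \<in> carrier L" "c' \<sqsubseteq> c" "c' \<sqsubseteq> bval_eq L z x"
        then have x: "x \<in> N" "name L x"
          using pE by auto
        have c'\<Omega>: "c' \<sqsubseteq> bval_mem L z \<Omega>"
          using c' c c\<Omega> cl by (meson le_trans)
        show "c' \<sqsubseteq> bval_mem L z D"
        proof (rule bval_memE[OF c'\<Omega> z names(2) c'(1) cl(3)])
          fix c'' w b assume "(w, b) \<in> pairs \<Omega>"
            and c'': "c'' \<in> carrier L" "c'' \<sqsubseteq> c'" "c'' \<sqsubseteq> bval_eq L z w"
          then obtain \<alpha> where \<alpha>: "\<alpha> \<in> elts omega1" "w = check_name L \<alpha>"
            using p\<Omega> by auto
          have zx: "bval_eq L z x \<in> carrier L"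
            using z x bval_eq_closed by blast
          show "c'' \<sqsubseteq> bval_mem L z D"
          proof (cases "\<alpha> \<in> N")
            case True
            then have "(w, \<top>) \<in> pairs D"
              using \<alpha> pD by auto
            then show ?thesis
              using c'' z names by (intro bval_memI[of w \<top>]) auto
          next
            \<comment> \<open>Here \<open>c''\<close> forces \<open>x\<close> to be an ordinal
              outside \<open>N\<close>, so it is zero and lies below everything.\<close>
            case False
            have w: "name L w"
              using \<alpha> name_check_name by simp
            have "c'' \<sqsubseteq> bval_eq L x z"
              using le_trans[OF c''(2) c'(3)] c'' c' zx bval_eq_sym[of x z] by simp
            then have "c'' \<sqsubseteq> bval_eq L x w"
              using bval_eq_trans c'' x z w by blast
            moreover have "c'' \<sqsubseteq> q"
              using c c' c'' q by (meson le_trans)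
            ultimately have "c'' \<sqsubseteq> q \<sqinter> bval_eq L x w"
              using c'' q bval_eq_closed x w by (intro meet_le) auto
            then have "c'' = \<bottom>"
              using decided[OF x, of \<alpha>] \<alpha> False le_bottom_iff c'' by simp
            then show ?thesis
              using cl by simp
          qed
        qed
      qed
    qed (use cl q in auto)
    moreover have "q \<sqsubseteq> ?r"
    proof (rule le_compl_meet_compl)
      fix c assume c: "c \<in> carrier L" "c \<sqsubseteq> bval_mem L z D"
      show "c \<sqsubseteq> bval_mem L z E \<sqinter> bval_mem L z \<Omega>"
      proof (rule bval_memE[OF c(2) z names(3) c(1)])
        fix c' w b assume "(w, b) \<in> pairs D" and c': "c' \<in> carrier L" "c' \<sqsubseteq> bval_eq L z w"
        then obtain \<alpha> where \<alpha>: "\<alpha> \<in> N \<inter> elts omega1" "w = check_name L \<alpha>"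
          using pD by auto
        have "(w, \<top>) \<in> pairs E" "(w, \<top>) \<in> pairs \<Omega>"
          using \<alpha> pE p\<Omega> check name_check_name by auto
        then have "c' \<sqsubseteq> bval_mem L z E" "c' \<sqsubseteq> bval_mem L z \<Omega>"
          using c' z names by (auto intro: bval_memI[of w \<top>])
        then show "c' \<sqsubseteq> bval_mem L z E \<sqinter> bval_mem L z \<Omega>"
          using cl c' by (intro meet_le)
      qed (use cl in auto)
    qed (use cl q in auto)
    ultimately show ?thesis
      using cl q by (intro meet_le) auto
  qed
  have cl: "bval_mem L z E \<in> carrier L" "bval_mem L z \<Omega> \<in> carrier L" "bval_mem L z D \<in> carrier L"
    if "name L z" for z
    using names that bval_mem_closed by auto
  have "q \<sqsubseteq> bval L inter_eq_fm (\<lambda>i. if i = 0 then E else if i = 1 then \<Omega> else D)"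
    unfolding inter_eq_fm_def Iff_def bval.simps
    by (intro inf_greatest) (use main cl q in \<open>auto\<close>)
  then show ?thesis
    unfolding forces_same_omega1_def forces_def E_def \<Omega>_def D_def .
qed

end


section \<open>Countable ordinals\<close>

lemma Ord_in_Ord: "Ord x \<Longrightarrow> y \<in> elts x \<Longrightarrow> Ord y"
  unfolding Ord_def by blast

lemma Ord_trans: "Ord x \<Longrightarrow> y \<in> elts x \<Longrightarrow> elts y \<subseteq> elts x"
  unfolding Ord_def by blast

lemma Ord_linear: "Ord x \<Longrightarrow> Ord y \<Longrightarrow> x \<in> elts y \<or> x = y \<or> y \<in> elts x"
  using wf_mem_rel
proof (induction x arbitrary: y rule: wf_induct_rule)
  case (less x)
  note x = less
  show ?case
    using wf_mem_rel \<open>Ord y\<close>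
  proof (induction y rule: wf_induct_rule)
    case (less y)
    show ?case
    proof (rule ccontr)
      assume neg: "\<not> ?case"
      have "x' \<in> elts y" if "x' \<in> elts x" for x'
      proof -
        have "x' \<in> elts y \<or> x' = y \<or> y \<in> elts x'"
          using x that less.prems Ord_in_Ord by (auto simp: mem_rel_def)
        then show ?thesis
          using neg that Ord_trans[OF \<open>Ord x\<close> that] by blast
      qed
      moreover have "y' \<in> elts x" if "y' \<in> elts y" for y'
      proof -
        have "x \<in> elts y' \<or> x = y' \<or> y' \<in> elts x"
          using less.IH[of y'] that Ord_in_Ord[OF less.prems that] by (simp add: mem_rel_def)
        then show ?thesis
          using neg that Ord_trans[OF less.prems that] by blast
      qed
      ultimately have "elts x = elts y"
        by blast
      then show False
        using hset_ext neg by blast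
    qed
  qed
qed

lemma countable_segments_ordinals:
  "countable_segments {\<alpha>. Ord \<alpha> \<and> countable (elts \<alpha>)}
     {(\<beta>, \<alpha>). \<beta> \<in> elts \<alpha> \<and> Ord \<alpha> \<and> countable (elts \<alpha>)}"
  (is "countable_segments ?W ?r")
proof
  show "wf ?r"
    by (rule wf_subset[OF wf_mem_rel]) (auto simp: mem_rel_def)
  show "trans ?r"
    unfolding trans_def using Ord_trans by blast
  show "total_on ?W ?r"
    unfolding total_on_def using Ord_linear by blast
  show "?r \<subseteq> ?W \<times> ?W"
    using Ord_in_Ord countable_subset[OF Ord_trans] by auto
qed simp


section \<open>Bounds on transitive closures\<close>

lemma tc_subset:
  assumes "elts x \<subseteq> S" "\<And>y. y \<in> S \<Longrightarrow> elts y \<subseteq> S"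
  shows "tc x \<subseteq> S"
proof
  fix y assume "y \<in> tc x"
  then have "(y, x) \<in> mem_rel\<^sup>+"
    by (simp add: tc_def)
  then show "y \<in> S"
    by (induction rule: converse_trancl_induct) (use assms in \<open>auto simp: mem_rel_def\<close>)
qed

lemma elts_subset_tc: "y \<in> tc x \<Longrightarrow> elts y \<subseteq> tc x"
proof
  fix z assume "y \<in> tc x" "z \<in> elts y"
  then have "(z, y) \<in> mem_rel" "(y, x) \<in> mem_rel\<^sup>+"
    by (simp_all add: tc_def mem_rel_def)
  then show "z \<in> tc x"
    unfolding tc_def by (blast intro: trancl_into_trancl2)
qed

lemma elts_subset_tc_self: "elts x \<subseteq> tc x"
proof
  fix y assume "y \<in> elts x"
  then have "(y, x) \<in> mem_rel"
    by (simp add: mem_rel_def)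
  then show "y \<in> tc x"
    unfolding tc_def by blast
qed

lemma elts_hpair: "elts (hpair x y) = {hset_of {x}, hset_of {x, y}}"
  by (simp add: hpair_def elts_hset_of_countable)

lemma elts_singleton: "elts (hset_of {x}) = {x}"
  by (simp add: elts_hset_of_countable)

lemma elts_doubleton: "elts (hset_of {x, y}) = {x, y}"
  by (simp add: elts_hset_of_countable)

lemma hfst_in_tc: "C \<in> tc (hpair C R)"
proof -
  have "(C, hset_of {C}) \<in> mem_rel" "(hset_of {C}, hpair C R) \<in> mem_rel"
    by (simp_all add: mem_rel_def elts_hpair elts_singleton)
  then show ?thesis
    unfolding tc_def by (blast intro: trancl.intros)
qed

text \<open>The right-hand side is transitive. For countable \<open>\<alpha>\<close> it consists of
  countably many sets besides the top element and its closure, which for \<open>alg B\<close> lie in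
  \<open>tc B\<close>.\<close>

lemma tc_check_name:
  assumes "Ord \<alpha>"
  shows "tc (check_name L \<alpha>) \<subseteq>
    (\<Union>\<beta> \<in> elts \<alpha>. {hpair (check_name L \<beta>) \<top>\<^bsub>L\<^esub>, hset_of {check_name L \<beta>},
       hset_of {check_name L \<beta>, \<top>\<^bsub>L\<^esub>}, check_name L \<beta>}) \<union> insert \<top>\<^bsub>L\<^esub> (tc \<top>\<^bsub>L\<^esub>)"
    (is "_ \<subseteq> ?S")
proof (rule tc_subset)
  show "elts (check_name L \<alpha>) \<subseteq> ?S"
    by (auto simp: elts_check_name)
  have "elts \<top>\<^bsub>L\<^esub> \<subseteq> tc \<top>\<^bsub>L\<^esub>"
    by (rule elts_subset_tc_self)
  moreover have "elts (check_name L \<beta>) \<subseteq> ?S" if "\<beta> \<in> elts \<alpha>" for \<beta>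
    using Ord_trans[OF assms that] by (auto simp: elts_check_name)
  ultimately show "elts y \<subseteq> ?S" if "y \<in> ?S" for y
    using that
  proof (elim UnE UN_E)
    fix \<beta> assume "\<beta> \<in> elts \<alpha>" and y: "y \<in> {hpair (check_name L \<beta>) \<top>\<^bsub>L\<^esub>, hset_of {check_name L \<beta>},
       hset_of {check_name L \<beta>, \<top>\<^bsub>L\<^esub>}, check_name L \<beta>}"
      and check: "\<And>\<beta>. \<beta> \<in> elts \<alpha> \<Longrightarrow> elts (check_name L \<beta>) \<subseteq> ?S"
    have "elts y \<subseteq> elts (check_name L \<beta>) \<union> {hset_of {check_name L \<beta>},
       hset_of {check_name L \<beta>, \<top>\<^bsub>L\<^esub>}, check_name L \<beta>, \<top>\<^bsub>L\<^esub>}"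
      using y by (auto simp: elts_hpair elts_singleton elts_doubleton)
    then show "elts y \<subseteq> ?S"
      using check[OF \<open>\<beta> \<in> elts \<alpha>\<close>] \<open>\<beta> \<in> elts \<alpha>\<close> by blast
  next
    assume "y \<in> insert \<top>\<^bsub>L\<^esub> (tc \<top>\<^bsub>L\<^esub>)"
    then have "elts y \<subseteq> tc \<top>\<^bsub>L\<^esub>"
      using elts_subset_tc elts_subset_tc_self by blast
    then show "elts y \<subseteq> ?S"
      by blast
  qed
qed

text \<open>The sum with the natural numbers absorbs countably many extra points, and
  \<open>large_for\<close> bounds even its power set.\<close>

lemma card_less_large:
  assumes "large_for B \<theta>" "A \<subseteq> C \<union> tc B" "countable C"
  shows "|A| <o \<theta>"
proof -
  define g where "g = case_sum (\<lambda>x. x) (from_nat_into C)"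
  have "A \<subseteq> g ` (tc B <+> UNIV)"
  proof
    fix x assume "x \<in> A"
    then consider "x \<in> tc B" | "x \<in> C"
      using assms(2) by blast
    then show "x \<in> g ` (tc B <+> UNIV)"
    proof cases
      case 1
      then show ?thesis
        by (intro image_eqI[of _ _ "Inl x"]) (auto simp: g_def)
    next
      case 2
      then obtain n where "from_nat_into C n = x"
        using from_nat_into_surj[OF assms(3)] by blast
      then show ?thesis
        by (intro image_eqI[of _ _ "Inr n"]) (auto simp: g_def)
    qed
  qed
  then have "|A| \<le>o |tc B <+> (UNIV :: nat set)|"
    by (rule surj_imp_ordLeq)
  also have "|tc B <+> (UNIV :: nat set)| <o |Pow (tc B <+> (UNIV :: nat set))|"
    by (rule card_of_Pow)
  finally show ?thesis
    using assms(1) ordLess_transitive unfolding large_for_def by blast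
qed

text \<open>Codes bound the number of countable ordinals by the continuum, which
  \<open>large_for\<close> puts below \<open>\<theta>\<close>, and \<open>\<theta>\<close> is at
  most the size of \<open>'u\<close>. So the universe is large enough for this set.\<close>

lemma elts_omega1:
  fixes \<theta> :: "'u rel" and B :: "'u hset"
  assumes "Cinfinite \<theta>" "large_for B \<theta>"
  shows "elts (omega1 :: 'u hset) = {\<alpha>. Ord \<alpha> \<and> countable (elts \<alpha>)}"
  unfolding omega1_def
proof (rule elts_hset_of)
  interpret countable_segments "{\<alpha> :: 'u hset. Ord \<alpha> \<and> countable (elts \<alpha>)}"
      "{(\<beta>, \<alpha>). \<beta> \<in> elts \<alpha> \<and> Ord \<alpha> \<and> countable (elts \<alpha>)}"
    by (rule countable_segments_ordinals)
  have "(UNIV :: (nat \<times> nat) set set) \<subseteq>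
      (\<lambda>S. {z. Inr (prod_encode z) \<in> S}) ` Pow (tc B <+> (UNIV :: nat set))"
  proof
    fix X :: "(nat \<times> nat) set"
    have "X = {z. Inr (prod_encode z) \<in> Inr ` prod_encode ` X}"
      by (auto dest: inj_onD[OF inj_prod_encode])
    moreover have "Inr ` prod_encode ` X \<in> Pow (tc B <+> (UNIV :: nat set))"
      by auto
    ultimately show "X \<in> (\<lambda>S. {z. Inr (prod_encode z) \<in> S}) ` Pow (tc B <+> (UNIV :: nat set))"
      by blast
  qed
  then have "|UNIV :: (nat \<times> nat) set set| \<le>o |Pow (tc B <+> (UNIV :: nat set))|"
    by (rule surj_imp_ordLeq)
  then have "|{\<alpha> :: 'u hset. Ord \<alpha> \<and> countable (elts \<alpha>)}| <o \<theta>"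
    using card_le_continuum assms(2) ordLeq_transitive ordLeq_ordLess_trans
    unfolding large_for_def by blast
  moreover have "\<theta> \<le>o |UNIV :: 'u set|"
    using assms(1) card_of_Field_ordIso[of \<theta>] card_of_mono1[OF subset_UNIV, of "Field \<theta>"]
    unfolding cinfinite_def by (meson ordIso_ordLeq_trans ordIso_symmetric)
  moreover have "|UNIV :: 'u set| \<le>o |UNIV :: ('u + nat) set|"
    by (rule card_of_ordLeqI[of Inl]) auto
  ultimately show "|{\<alpha> :: 'u hset. Ord \<alpha> \<and> countable (elts \<alpha>)}| \<le>o |UNIV :: ('u + nat) set|"
    by (meson ordLeq_transitive ordLess_imp_ordLeq)
qed

lemma check_name_in_H:
  assumes B: "is_complete_BA B" and \<theta>: "large_for B \<theta>" and \<alpha>: "Ord \<alpha>" "countable (elts \<alpha>)"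
  shows "check_name (alg B) \<alpha> \<in> H \<theta>"
proof -
  let ?L = "alg B"
  obtain C R where CR: "B = hpair C R"
    using B unfolding is_complete_BA_def by blast
  interpret complete_lattice ?L
    using B unfolding is_complete_BA_def complete_BA_def by blast
  have "\<top>\<^bsub>?L\<^esub> \<in> elts C"
    using top_closed by (simp add: alg_def CR)
  then have top: "\<top>\<^bsub>?L\<^esub> \<in> tc B"
    using hfst_in_tc[of C R] elts_subset_tc[of C B] CR by blast
  moreover have "tc \<top>\<^bsub>?L\<^esub> \<subseteq> tc B"
    using elts_subset_tc[OF top] elts_subset_tc by (rule tc_subset)
  ultimately have "tc (check_name ?L \<alpha>) \<subseteq>
    (\<Union>\<beta> \<in> elts \<alpha>. {hpair (check_name ?L \<beta>) \<top>\<^bsub>?L\<^esub>, hset_of {check_name ?L \<beta>},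
       hset_of {check_name ?L \<beta>, \<top>\<^bsub>?L\<^esub>}, check_name ?L \<beta>}) \<union> tc B"
    using tc_check_name[OF \<alpha>(1), of ?L] by blast
  from card_less_large[OF \<theta> this] show ?thesis
    using \<alpha>(2) by (simp add: H_def)
qed

lemma countable_Ord_in_H:
  assumes "large_for B \<theta>" "Ord \<alpha>" "countable (elts \<alpha>)"
  shows "\<alpha> \<in> H \<theta>"
proof -
  have "tc \<alpha> \<subseteq> elts \<alpha>"
    using Ord_trans[OF assms(2)] by (intro tc_subset) auto
  then show ?thesis
    using card_less_large[OF assms(1) _ assms(3), of "tc \<alpha>"] by (auto simp: H_def)
qed


section \<open>Clubs of elementary submodels\<close>

lemma lists_chain:
  fixes F :: "nat \<Rightarrow> 'a set"
  assumes "\<And>n. F n \<subseteq> F (Suc n)" "ys \<in> lists (\<Union>n. F n)"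
  shows "\<exists>n. ys \<in> lists (F n)"
  using assms(2)
proof (induction ys)
  case (Cons y ys)
  then obtain m n where "y \<in> F m" "ys \<in> lists (F n)"
    by auto
  moreover have "F i \<subseteq> F (max m n)" if "i \<le> max m n" for i
    using that assms(1) lift_Suc_mono_le by blast
  ultimately have "y # ys \<in> lists (F (max m n))"
    using max.cobounded1[of m n] max.cobounded2[of n m] by (meson Cons_in_lists_iff lists_mono subsetD)
  then show ?case ..
qed simp

text \<open>Closing off takes \<open>\<omega>\<close> steps, since a finite sequence from the union
  of a chain already lies in one of its members.\<close>

lemma club_closed_sets:
  assumes F: "\<And>ys. ys \<in> lists X \<Longrightarrow> F ys \<subseteq> X \<and> countable (F ys)"
  shows "club X {N. N \<subseteq> X \<and> countable N \<and> (\<forall>ys \<in> lists N. F ys \<subseteq> N)}" (is "club X ?C")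
  unfolding club_def
proof (intro conjI allI impI)
  fix A assume A: "A \<subseteq> X \<and> countable A"
  define S where "S n = ((\<lambda>N. N \<union> (\<Union>ys \<in> lists N. F ys)) ^^ n) A" for n
  have S: "S 0 = A" "\<And>n. S (Suc n) = S n \<union> (\<Union>ys \<in> lists (S n). F ys)"
    by (simp_all add: S_def)
  have SX: "S n \<subseteq> X \<and> countable (S n)" for n
  proof (induction n)
    case (Suc n)
    have "F ys \<subseteq> X \<and> countable (F ys)" if "ys \<in> lists (S n)" for ys
      by (rule F, rule subsetD[OF lists_mono that]) (use Suc in simp)
    then show ?case
      using Suc unfolding S(2) by (auto intro!: countable_UN)
  qed (use A S in auto)
  have "F ys \<subseteq> (\<Union>n. S n)" if ys: "ys \<in> lists (\<Union>n. S n)" for ys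
  proof -
    obtain n where "ys \<in> lists (S n)"
      using lists_chain[of S ys] ys S(2) by blast
    then have "F ys \<subseteq> S (Suc n)"
      unfolding S(2) by blast
    then show ?thesis
      by blast
  qed
  then have "(\<Union>n. S n) \<in> ?C"
    using SX by auto
  moreover have "A \<subseteq> (\<Union>n. S n)"
    using S(1) by blast
  ultimately show "\<exists>N \<in> ?C. A \<subseteq> N"
    by blast
next
  fix G :: "nat \<Rightarrow> 'a set" assume G: "\<forall>n. G n \<in> ?C \<and> G n \<subseteq> G (Suc n)"
  have "F ys \<subseteq> (\<Union>n. G n)" if ys: "ys \<in> lists (\<Union>n. G n)" for ys
  proof -
    obtain n where "ys \<in> lists (G n)"
      using lists_chain[of G ys] ys G by blast
    then have "F ys \<subseteq> G n"
      using G by blast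
    then show ?thesis
      by blast
  qed
  then show "(\<Union>n. G n) \<in> ?C"
    using G by auto
qed auto

section \<open>Skolem witnesses\<close>

instance fm :: countable
  by countable_datatype

text \<open>Lets finite lists stand for assignments, so that closure under finite sequences yields
  elementarity.\<close>

lemma sat_finite_support: "\<exists>n. \<forall>e e'. (\<forall>k < n. e k = e' k) \<longrightarrow> sat M \<phi> e = sat M \<phi> e'"
proof (induction \<phi>)
  case (Mem i j)
  then show ?case
    by (intro exI[of _ "Suc (max i j)"]) simp
next
  case (Eq i j)
  then show ?case
    by (intro exI[of _ "Suc (max i j)"]) simp
next
  case (Neg \<phi>)
  then show ?case
    by simp
next
  case (Conj \<phi> \<psi>)
  then obtain m n where "\<And>e e'. (\<forall>k < m. e k = e' k) \<Longrightarrow> sat M \<phi> e = sat M \<phi> e'"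
      "\<And>e e'. (\<forall>k < n. e k = e' k) \<Longrightarrow> sat M \<psi> e = sat M \<psi> e'"
    by blast
  then have "\<forall>e e'. (\<forall>k < max m n. e k = e' k) \<longrightarrow> sat M (Conj \<phi> \<psi>) e = sat M (Conj \<phi> \<psi>) e'"
    unfolding sat.simps by (metis less_max_iff_disj)
  then show ?case ..
next
  case (All i \<phi>)
  then obtain n where n: "\<And>e e'. (\<forall>k < n. e k = e' k) \<Longrightarrow> sat M \<phi> e = sat M \<phi> e'"
    by blast
  have "sat M (All i \<phi>) e = sat M (All i \<phi>) e'" if "\<forall>k < n. e k = e' k" for e e'
    unfolding sat.simps using that by (intro ball_cong HOL.refl n) simp
  then show ?case
    by blast
qed

text \<open>The witnesses are counterexamples because \<open>All\<close> is the primitive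
  quantifier. Beyond its length \<open>ys\<close> has unspecified entries, harmless for formulas
  whose support it covers.\<close>

definition skolem :: "'u hset set \<Rightarrow> 'u hset list \<Rightarrow> 'u hset set" where
  "skolem M ys = {SOME x. x \<in> M \<and> \<not> sat M \<phi> (((!) ys)(i := x)) | \<phi> i.
     \<exists>x. x \<in> M \<and> \<not> sat M \<phi> (((!) ys)(i := x))}"

lemma countable_skolem: "countable (skolem M ys)"
proof -
  have "skolem M ys \<subseteq> (\<lambda>(\<phi>, i). SOME x. x \<in> M \<and> \<not> sat M \<phi> (((!) ys)(i := x))) ` UNIV"
    unfolding skolem_def by auto
  then show ?thesis
    by (rule countable_subset) simp
qed

lemma skolem_subset: "skolem M ys \<subseteq> M"
proof
  fix y assume "y \<in> skolem M ys"
  then obtain \<phi> i where "\<exists>x. x \<in> M \<and> \<not> sat M \<phi> (((!) ys)(i := x))"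
      "y = (SOME x. x \<in> M \<and> \<not> sat M \<phi> (((!) ys)(i := x)))"
    unfolding skolem_def by blast
  then show "y \<in> M"
    using someI_ex[of "\<lambda>x. x \<in> M \<and> \<not> sat M \<phi> (((!) ys)(i := x))"] by simp
qed

text \<open>The Tarski-Vaught criterion: a universal formula that fails in \<open>M\<close> has its
  chosen counterexample in \<open>N\<close>.\<close>

lemma elementary_submodel_skolem:
  assumes NM: "N \<subseteq> M" and sk: "\<And>ys. ys \<in> lists N \<Longrightarrow> skolem M ys \<subseteq> N"
  shows "elementary_submodel N M"
proof -
  have "range e \<subseteq> N \<Longrightarrow> sat N \<phi> e \<longleftrightarrow> sat M \<phi> e" for \<phi> e
  proof (induction \<phi> arbitrary: e)
    case (All i \<phi>)
    have upd: "sat N \<phi> (e(i := x)) \<longleftrightarrow> sat M \<phi> (e(i := x))" if "x \<in> N" for x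
      using All that by (intro All.IH) auto
    have "sat M \<phi> (e(i := x))" if N: "\<forall>x \<in> N. sat N \<phi> (e(i := x))" and x: "x \<in> M" for x
    proof (rule ccontr)
      assume neg: "\<not> ?thesis"
      obtain n where n: "\<And>e e'. (\<forall>k < n. e k = e' k) \<Longrightarrow> sat M \<phi> e = sat M \<phi> e'"
        using sat_finite_support[of M \<phi>] by blast
      define ys where "ys = map e [0..<n]"
      have ys: "sat M \<phi> (((!) ys)(i := z)) = sat M \<phi> (e(i := z))" for z
        by (rule n) (simp add: ys_def)
      define s where "s = (SOME x. x \<in> M \<and> \<not> sat M \<phi> (((!) ys)(i := x)))"
      have ex: "\<exists>x. x \<in> M \<and> \<not> sat M \<phi> (((!) ys)(i := x))"
        using neg x ys by blast
      then have "s \<in> skolem M ys"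
        unfolding skolem_def s_def by blast
      moreover have "ys \<in> lists N"
        using All.prems by (simp add: ys_def in_lists_conv_set image_subset_iff)
      ultimately have "s \<in> N"
        using sk by blast
      moreover have "s \<in> M \<and> \<not> sat M \<phi> (((!) ys)(i := s))"
        unfolding s_def by (rule someI_ex[OF ex])
      ultimately show False
        using upd N ys by blast
    qed
    then show ?case
      using upd NM by auto
  qed simp_all
  then show ?thesis
    using NM unfolding elementary_submodel_def by blast
qed


section \<open>Semiproperness\<close>

theorem theorem1:
  fixes B :: "'u hset"
  assumes "is_complete_BA B"
    and "\<exists>\<sigma>. winning_strategy_II (alg B) \<sigma>"
  shows "semiproper B"
  unfolding semiproper_def
proof (intro allI impI)
  fix \<theta> :: "'u rel"
  assume "Cinfinite \<theta> \<and> regularCard \<theta> \<and> large_for B \<theta>"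
  then have \<theta>: "Cinfinite \<theta>" "large_for B \<theta>"
    by blast+
  define L where "L = alg B"
  interpret hset_boolean L
    using assms(1)
    unfolding hset_boolean_def complete_boolean_def complete_boolean_axioms_def L_def is_complete_BA_def
    by (simp add: complete_BA_def)
  obtain \<sigma> where \<sigma>: "winning_strategy_II L \<sigma>"
    using assms(2) L_def by blast
  have om: "elts (omega1 :: 'u hset) = {\<alpha>. Ord \<alpha> \<and> countable (elts \<alpha>)}"
    using elts_omega1 \<theta> by blast
  have segments: "countable_segments (elts omega1)
      {(\<beta>, \<alpha> :: 'u hset). \<beta> \<in> elts \<alpha> \<and> Ord \<alpha> \<and> countable (elts \<alpha>)}"
    unfolding om by (rule countable_segments_ordinals)
  have omH: "elts omega1 \<subseteq> H \<theta>"
    using countable_Ord_in_H[OF \<theta>(2)] by (auto simp: om)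
  have checkH: "check_name L ` elts omega1 \<subseteq> H \<theta>"
    using check_name_in_H[OF assms(1) \<theta>(2)] by (auto simp: om L_def)
  have BH: "B \<in> H \<theta>"
    using card_less_large[OF \<theta>(2), of "tc B" "{}"] by (simp add: H_def)
  \<comment> \<open>The value zero for sets that are not names allows all elements of a model to be
    treated alike.\<close>
  define a where "a x \<alpha> = (if name L x then bval_eq L x (check_name L \<alpha>) else \<bottom>\<^bsub>L\<^esub>)" for x \<alpha>
  have a: "a x \<alpha> \<in> carrier L" for x \<alpha>
    by (simp add: a_def bval_eq_closed name_check_name)
  have a_disj: "a x \<alpha> \<sqinter>\<^bsub>L\<^esub> a x \<beta> = \<bottom>\<^bsub>L\<^esub>" if "\<alpha> \<noteq> \<beta>" for x \<alpha> \<beta>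
    using that by (simp add: a_def bval_eq_check_name_disjoint meet_bottom)
  obtain A where A: "\<And>p. p \<in> carrier L \<Longrightarrow> p \<noteq> \<bottom>\<^bsub>L\<^esub> \<Longrightarrow> winning p (A p)"
    using winning_answers[OF \<sigma>] by metis
  \<comment> \<open>For each \<open>p\<close>, position \<open>bs\<close> and set \<open>x\<close>,
    a continuation and a countable set of candidates for \<open>x\<close> are fixed before any model
    is considered.\<close>
  have "\<forall>z. \<exists>v. case z of (p, bs, x) \<Rightarrow> p \<in> carrier L \<and> p \<noteq> \<bottom>\<^bsub>L\<^esub> \<and> set bs \<subseteq> carrier L \<longrightarrow>
      fst v \<noteq> [] \<and> set (fst v) \<subseteq> carrier L \<and> snd v \<subseteq> elts omega1 \<and> countable (snd v) \<and>
      (\<forall>q \<in> carrier L. consistent (A p) (bs @ fst v) q \<longrightarrow>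
         (\<forall>\<alpha> \<in> elts omega1 - snd v. q \<sqinter>\<^bsub>L\<^esub> a x \<alpha> = \<bottom>\<^bsub>L\<^esub>))"
  proof (rule allI)
    fix z :: "'u hset \<times> 'u hset list \<times> 'u hset"
    obtain p bs x where z: "z = (p, bs, x)"
      by (cases z)
    show "\<exists>v. case z of (p, bs, x) \<Rightarrow> p \<in> carrier L \<and> p \<noteq> \<bottom>\<^bsub>L\<^esub> \<and> set bs \<subseteq> carrier L \<longrightarrow>
      fst v \<noteq> [] \<and> set (fst v) \<subseteq> carrier L \<and> snd v \<subseteq> elts omega1 \<and> countable (snd v) \<and>
      (\<forall>q \<in> carrier L. consistent (A p) (bs @ fst v) q \<longrightarrow>
         (\<forall>\<alpha> \<in> elts omega1 - snd v. q \<sqinter>\<^bsub>L\<^esub> a x \<alpha> = \<bottom>\<^bsub>L\<^esub>))"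
    proof (cases "p \<in> carrier L \<and> p \<noteq> \<bottom>\<^bsub>L\<^esub> \<and> set bs \<subseteq> carrier L")
      case True
      then have "\<exists>cs U. cs \<noteq> [] \<and> set cs \<subseteq> carrier L \<and> U \<subseteq> elts omega1 \<and> countable U \<and>
        (\<forall>q \<in> carrier L. consistent (A p) (bs @ cs) q \<longrightarrow>
           (\<forall>\<alpha> \<in> elts omega1 - U. q \<sqinter>\<^bsub>L\<^esub> a x \<alpha> = \<bottom>\<^bsub>L\<^esub>))"
        using a a_disj by (intro decide_countably[OF A _ segments]) auto
      then show ?thesis
        unfolding z by auto
    qed (auto simp: z)
  qed
  from choice[OF this] obtain v where v_all: "\<And>z. case z of (p, bs, x) \<Rightarrow>
      p \<in> carrier L \<and> p \<noteq> \<bottom>\<^bsub>L\<^esub> \<and> set bs \<subseteq> carrier L \<longrightarrow>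
      fst (v z) \<noteq> [] \<and> set (fst (v z)) \<subseteq> carrier L \<and> snd (v z) \<subseteq> elts omega1 \<and> countable (snd (v z)) \<and>
      (\<forall>q \<in> carrier L. consistent (A p) (bs @ fst (v z)) q \<longrightarrow>
         (\<forall>\<alpha> \<in> elts omega1 - snd (v z). q \<sqinter>\<^bsub>L\<^esub> a x \<alpha> = \<bottom>\<^bsub>L\<^esub>))"
    by blast
  have v: "fst (v (p, bs, x)) \<noteq> []" "set (fst (v (p, bs, x))) \<subseteq> carrier L"
      "snd (v (p, bs, x)) \<subseteq> elts omega1" "countable (snd (v (p, bs, x)))"
      "\<And>q \<alpha>. q \<in> carrier L \<Longrightarrow> consistent (A p) (bs @ fst (v (p, bs, x))) q \<Longrightarrow>
         \<alpha> \<in> elts omega1 - snd (v (p, bs, x)) \<Longrightarrow> q \<sqinter>\<^bsub>L\<^esub> a x \<alpha> = \<bottom>\<^bsub>L\<^esub>"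
    if "p \<in> carrier L" "p \<noteq> \<bottom>\<^bsub>L\<^esub>" "set bs \<subseteq> carrier L" for p bs x
    using v_all[of "(p, bs, x)"] that by simp_all
  \<comment> \<open>The position reached when the entries of a list are treated in order.\<close>
  define pos where "pos p = foldl (\<lambda>bs x. bs @ fst (v (p, bs, x))) []" for p
  have pos: "set (pos p xs) \<subseteq> carrier L" if "p \<in> carrier L" "p \<noteq> \<bottom>\<^bsub>L\<^esub>" for p xs
  proof (induction xs rule: rev_induct)
    case (snoc x xs)
    then show ?case
      using v(2)[OF that, of "pos p xs" x] by (simp add: pos_def)
  qed (simp add: pos_def)
  \<comment> \<open>The list \<open>p # x # xs\<close> encodes the request for the candidates for
    \<open>x\<close> after \<open>xs\<close> has been treated, so that closure under finite
    sequences covers it.\<close>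
  define cand where "cand ys = (case ys of p # x # xs \<Rightarrow>
      if p \<in> carrier L \<and> p \<noteq> \<bottom>\<^bsub>L\<^esub> then snd (v (p, pos p xs, x)) else {} | _ \<Rightarrow> {})" for ys
  have cand: "cand ys \<subseteq> elts omega1 \<and> countable (cand ys)" for ys
    using v(3,4)[OF _ _ pos] by (simp add: cand_def split: list.split)
  define F where "F ys = insert B (skolem (H \<theta>) ys \<union> check_name L ` (set ys \<inter> elts omega1) \<union> cand ys)" for ys
  have F: "F ys \<subseteq> H \<theta> \<and> countable (F ys)" for ys
    unfolding F_def using BH skolem_subset[of "H \<theta>" ys] checkH cand[of ys] omH countable_skolem[of "H \<theta>" ys]
    by (auto intro: countable_finite)
  define \<C> where "\<C> = {N. N \<subseteq> H \<theta> \<and> countable N \<and> (\<forall>ys \<in> lists N. F ys \<subseteq> N)}"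
  have club: "club (H \<theta>) \<C>"
    unfolding \<C>_def by (rule club_closed_sets) (rule F)
  have good: "elementary_submodel N (H \<theta>) \<and> B \<in> N \<and>
      (\<forall>p \<in> N \<inter> carrier L. p \<noteq> \<bottom>\<^bsub>L\<^esub> \<longrightarrow>
         (\<exists>q \<in> carrier L. q \<noteq> \<bottom>\<^bsub>L\<^esub> \<and> q \<sqsubseteq>\<^bsub>L\<^esub> p \<and> forces_same_omega1 L q N))"
    if "N \<in> \<C>" for N
  proof (intro conjI ballI impI)
    have N: "N \<subseteq> H \<theta>" "countable N" "\<And>ys. ys \<in> lists N \<Longrightarrow> F ys \<subseteq> N"
      using that by (auto simp: \<C>_def)
    show "elementary_submodel N (H \<theta>)"
      using N(1,3) by (intro elementary_submodel_skolem) (auto simp: F_def)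
    show "B \<in> N"
      using N(3)[of "[]"] by (simp add: F_def)
    fix p assume "p \<in> N \<inter> carrier L" and p0: "p \<noteq> \<bottom>\<^bsub>L\<^esub>"
    then have p: "p \<in> N" "p \<in> carrier L"
      by auto
    define y where "y = from_nat_into N"
    have y: "range y = N"
      unfolding y_def using N(2) p(1) by (intro range_from_nat_into) auto
    \<comment> \<open>Player I treats the elements of \<open>N\<close> in their enumeration
      \<open>y\<close>, and \<open>l n\<close> is the position before \<open>y n\<close>. These
      positions unite to one run, for which II has a condition \<open>q\<close>.\<close>
    define l where "l n = pos p (map y [0..<n])" for n
    have l_Suc: "l (Suc n) = l n @ fst (v (p, l n, y n))" for n
      by (simp add: l_def pos_def)
    have l: "set (l n) \<subseteq> carrier L" for n
      unfolding l_def by (rule pos[OF p(2) p0])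
    have "\<exists>vs. vs \<noteq> [] \<and> l (Suc n) = l n @ vs" for n
      using v(1)[OF p(2) p0 l, of n "y n"] l_Suc by blast
    then obtain f where f: "\<And>n. map f [0..<length (l n)] = l n" "\<And>n. n \<le> length (l n)"
      using list_chain_limit by metis
    have "range f \<subseteq> carrier L"
    proof clarify
      fix n
      have "f n \<in> set (map f [0..<length (l (Suc n))])"
        using f(2)[of "Suc n"] by auto
      then have "f n \<in> set (l (Suc n))"
        unfolding f(1) .
      then show "f n \<in> carrier L"
        using l[of "Suc n"] by blast
    qed
    with A[OF p(2) p0, unfolded winning_def, rule_format, of f]
    obtain q where q: "q \<in> carrier L" "q \<noteq> \<bottom>\<^bsub>L\<^esub>" "q \<sqsubseteq>\<^bsub>L\<^esub> p"
        "\<And>n. consistent (A p) (map f [0..<n]) q"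
      by blast
    have dec: "q \<sqinter>\<^bsub>L\<^esub> bval_eq L x (check_name L \<alpha>) = \<bottom>\<^bsub>L\<^esub>"
      if "x \<in> N" "name L x" "\<alpha> \<in> elts omega1 - N" for x \<alpha>
    proof -
      have "x \<in> range y"
        using that(1) by (simp add: y)
      then obtain n where n: "x = y n"
        by (elim rangeE)
      \<comment> \<open>Only finitely many elements of \<open>N\<close> precede \<open>x\<close>, so
        its candidates come from a finite sequence in \<open>N\<close> and lie in \<open>N\<close>.
        The whole run is not asked to belong to \<open>N\<close>.\<close>
      have "cand (p # x # map y [0..<n]) \<subseteq> N"
      proof -
        have "p # x # map y [0..<n] \<in> lists N"
          using p(1) that(1) by (auto simp: y[symmetric])
        from N(3)[OF this] show ?thesis
          by (simp add: F_def)
      qed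
      then have "snd (v (p, l n, x)) \<subseteq> N"
        using p(2) p0 by (simp add: cand_def l_def)
      then have "\<alpha> \<in> elts omega1 - snd (v (p, l n, x))"
        using that(3) by blast
      moreover have "consistent (A p) (l (Suc n)) q"
        using q(4)[of "length (l (Suc n))"] unfolding f(1) .
      ultimately have "q \<sqinter>\<^bsub>L\<^esub> a x \<alpha> = \<bottom>\<^bsub>L\<^esub>"
        unfolding l_Suc n by (intro v(5)[OF p(2) p0 l q(1)])
      then show ?thesis
        using that(2) by (simp add: a_def)
    qed
    have check: "check_name L \<alpha> \<in> N" if "\<alpha> \<in> N \<inter> elts omega1" for \<alpha>
      using N(3)[of "[\<alpha>]"] that by (auto simp: F_def)
    have "forces_same_omega1 L q N"
      by (rule forces_same_omega1I[OF q(1) N(2) dec check])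
    with q(1-3) show "\<exists>q \<in> carrier L. q \<noteq> \<bottom>\<^bsub>L\<^esub> \<and> q \<sqsubseteq>\<^bsub>L\<^esub> p \<and> forces_same_omega1 L q N"
      by (intro bexI conjI)
  qed
  show "\<exists>\<C>. club (H \<theta>) \<C> \<and>
           (\<forall>N \<in> \<C>. elementary_submodel N (H \<theta>) \<and> B \<in> N \<and>
              (\<forall>p \<in> N \<inter> carrier (alg B). p \<noteq> \<bottom>\<^bsub>alg B\<^esub> \<longrightarrow>
                 (\<exists>q \<in> carrier (alg B). q \<noteq> \<bottom>\<^bsub>alg B\<^esub> \<and> q \<sqsubseteq>\<^bsub>alg B\<^esub> p \<and>
                    forces_same_omega1 (alg B) q N)))"
    unfolding L_def[symmetric] by (intro exI[of _ \<C>] conjI[OF club] ballI good)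
qed

end
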